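(* Let $\Omega$, $\mathbb{K}$, $g$ be as in the context, and let $\mathcal{A}_\sigma$ be a $\sigma$-algebra on $\mathbb{K}$ such that $z\mapsto\int_0^\infty\varrho(t)g(z(t))dt$ is $\mathcal{A}_\sigma$-measurable for every $\varrho\in\mathfrak{D}$. For each $\omega\in\Omega$ let $\mathcal{L}(\omega),\mathcal{M}(\omega)$ be nonempty sets, and for each $(l,m)\in\mathcal{L}(\omega)\times\mathcal{M}(\omega)$ let $\mathbb{M}^\omega_{lm}$ denote the expectation with respect to a given probability measure on $(\mathbb{K},\mathcal{A}_\sigma)$. For $\varrho\in\mathfrak{D}$ define $\mathcal{V}[\varrho](\omega)=\sup_{l\in\mathcal{L}(\omega)}\inf_{m\in\mathcal{M}(\omega)}\mathbb{M}^\omega_{lm}\int_0^\infty\varrho(t)g(z(t))dt$. Assume that for all $\varrho\in\mathfrak{D}$ and $T>0$ the maps $z\mapsto\int_0^\infty\varrho(t)g(z(t))dt$ and $z\mapsto\mathcal{V}[\varrho](z(T))$ are $\mathcal{A}_\sigma$-measurable, and that either the identity $$\mathcal{V}[\varrho](\omega)=\sup_{l\in\mathcal{L}(\omega)}\inf_{m\in\mathcal{M}(\omega)}\mathbb{M}^\omega_{lm}\Big[\int_0^T\varrho(t)g(z(t))dt+\sup_{l'\in\mathcal{L}(z(T))}\inf_{m'\in\mathcal{M}(z(T))}\mathbb{M}^{z(T)}_{l'm'}\int_0^\infty\varrho(t+T)g(z_1(t))dt\Big]$$ (outer expectation over $z$, inner over $z_1$) holds for all $\varrho\in\mathfrak{D}$,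 $\omega\in\Omega$ and all real $T>0$, or $z(n+s)=z(n)$ holds for all $z\in\mathbb{K}$, $n\in\mathbb{N}\cup\{0\}$, $s\in(0,1)$ and the identity holds for all $\varrho\in\mathfrak{D}$, $\omega\in\Omega$ and all $T\in\mathbb{N}$. Then for every $U_*:\Omega\to[0,1]$ the following are equivalent: (c) for every density $\mu\in\mathfrak{D}$ piecewise continuous on $(0,\infty)$, $\lim_{\lambda\to+0}\sup_{\omega}|\mathcal{V}[\mu^\lambda_{\mathrm{scale}}](\omega)-U_*(\omega)|=0$; (u) $\lim_{T\to+\infty}\sup_\omega|\mathcal{V}[\varpi_T](\omega)-U_*(\omega)|=0$; (e) $\lim_{\lambda\to+0}\sup_\omega|\mathcal{V}[\pi_\lambda](\omega)-U_*(\omega)|=0$; (p) for some power density $\varrho\in\mathfrak{D}$, $\lim_{T\to+\infty}\sup_\omega|\mathcal{V}[\varrho^T_{\mathrm{shift}}](\omega)-U_*(\omega)|=0$; (q) this holds for every power density $\varrho\in\mathfrak{D}$.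
   Context: $\mathbb{R}_+=[0,\infty)$. $\Omega$ is a nonempty set, $\mathbb{K}$ a nonempty set of maps $\mathbb{R}_+\to\Omega$, $g:\Omega\to[0,1]$ with $t\mapsto g(z(t))$ Lebesgue measurable for each $z\in\mathbb{K}$. $\mathfrak{D}$: probability densities $\varrho:\mathbb{R}_+\to\mathbb{R}_+$. For $T>0$ with $\int_T^\infty\varrho>0$: $\varrho^T_{\mathrm{shift}}(t)=\varrho(t+T)/\int_T^\infty\varrho$; for $\lambda>0$: $\varrho^\lambda_{\mathrm{scale}}(t)=\lambda\varrho(\lambda t)$. $\varpi_T(t)=\frac1T1_{[0,T]}(t)$, $\pi_\lambda(t)=\lambda e^{-\lambda t}$. A power density is $\varrho\in\mathfrak{D}$ with $\varrho(t)=(\alpha+\beta t)^{-\gamma}$ for some $\alpha,\beta,\gamma>0$. *)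

theory Defs
  imports "HOL-Probability.Probability"
begin

definition density_set :: "(real \<Rightarrow> real) set" where
  "density_set = {\<rho>. (\<forall>t\<ge>0. \<rho> t \<ge> 0) \<and> set_integrable lebesgue {0..} \<rho>
                     \<and> (LINT t:{0..}|lebesgue. \<rho> t) = 1}"

definition rho_shift :: "(real \<Rightarrow> real) \<Rightarrow> real \<Rightarrow> real \<Rightarrow> real" where
  "rho_shift \<rho> T = (\<lambda>t. \<rho> (t + T) / (LINT s:{T..}|lebesgue. \<rho> s))"

definition rho_scale :: "(real \<Rightarrow> real) \<Rightarrow> real \<Rightarrow> real \<Rightarrow> real" where
  "rho_scale \<rho> lam = (\<lambda>t. lam * \<rho> (lam * t))"

definition uniform_dens :: "real \<Rightarrow> real \<Rightarrow> real" where
  "uniform_dens T = (\<lambda>t. (1 / T) * indicator {0..T} t)"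

definition exp_dens :: "real \<Rightarrow> real \<Rightarrow> real" where
  "exp_dens lam = (\<lambda>t. lam * exp (- lam * t))"

definition power_density :: "(real \<Rightarrow> real) \<Rightarrow> bool" where
  "power_density \<rho> \<longleftrightarrow> \<rho> \<in> density_set \<and>
     (\<exists>\<alpha> \<beta> \<gamma>. \<alpha> > 0 \<and> \<beta> > 0 \<and> \<gamma> > 0 \<and> (\<forall>t\<ge>0. \<rho> t = (\<alpha> + \<beta> * t) powr (- \<gamma>)))"

definition piecewise_cont_pos :: "(real \<Rightarrow> real) \<Rightarrow> bool" where
  "piecewise_cont_pos \<mu> \<longleftrightarrow>
     (\<forall>a b. 0 < a \<and> a \<le> b \<longrightarrow> (\<exists>S. finite S \<and>
        (\<forall>t\<in>{a..b} - S. isCont \<mu> t) \<and>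
        (\<forall>s\<in>S. (\<exists>L. (\<mu> \<longlongrightarrow> L) (at_left s)) \<and> (\<exists>R. (\<mu> \<longlongrightarrow> R) (at_right s)))))"

definition payoff :: "('w \<Rightarrow> real) \<Rightarrow> (real \<Rightarrow> real) \<Rightarrow> (real \<Rightarrow> 'w) \<Rightarrow> real" where
  "payoff g f z = (LINT t:{0..}|lebesgue. f t * g (z t))"

definition game_value ::
  "('w \<Rightarrow> 'l set) \<Rightarrow> ('w \<Rightarrow> 'm set) \<Rightarrow> ('w \<Rightarrow> 'l \<Rightarrow> 'm \<Rightarrow> (real \<Rightarrow> 'w) measure)
    \<Rightarrow> ('w \<Rightarrow> real) \<Rightarrow> (real \<Rightarrow> real) \<Rightarrow> 'w \<Rightarrow> real" where
  "game_value L M P g f \<omega> =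
     (SUP l\<in>L \<omega>. INF m\<in>M \<omega>. integral\<^sup>L (P \<omega> l m) (payoff g f))"

end

theory Submission
  imports Defs "HOL-Real_Asymp.Real_Asymp"
begin

text \<open>
  Both variants of the dynamic programming hypothesis give the principle at all integer times, which
  suffices. Extend the value \<open>V\<close> homogeneously from densities to nonnegative integrable weights and call
  \<open>\<bar>V f - mass f * U\<bar>\<close> the deviation of \<open>f\<close>. The principle at time \<open>n\<close> bounds the deviation of \<open>f\<close> by
  that of any \<open>h\<close> of the same mass, plus the largest deviations of the shifts of \<open>f\<close> and \<open>h\<close> by \<open>n\<close>, plus
  twice the \<open>L\<^sup>1\<close> distance of \<open>f\<close> and \<open>h\<close> on \<open>[0, n)\<close>. This comparison is used twice.

  From uniform means to arbitrary scalings: a step function with first block of height \<open>a\<close> is compared with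
  the constant weight \<open>a\<close> on an interval of the same mass. By induction on the number of blocks step
  functions have small deviation, and they are dense in \<open>L\<^sup>1\<close>.

  Conversely, each shift of an exponential or power density \<open>\<mu>\<close> is a multiple of a slower scaling of \<open>\<mu>\<close>.
  Comparing the uniform density on \<open>[0, k N]\<close> with the scaling of \<open>\<mu>\<close> by \<open>1 / (\<mu> 0 k N)\<close> over the first
  \<open>N\<close> time units costs \<open>O(1 / k\<^sup>2)\<close>. Multiplied by the mass \<open>k N\<close> of the unnormalised interval, these errors
  sum up to \<open>N\<close> times a harmonic number, which is negligible against the length \<open>n N\<close> of the last interval.
\<close>

section \<open>Preliminaries\<close>

lemma set_integral_nonneg:
  fixes f :: "'a \<Rightarrow> real"
  assumes "\<And>x. x \<in> S \<Longrightarrow> 0 \<le> f x" shows "0 \<le> (LINT x:S|M. f x)"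
  unfolding set_lebesgue_integral_def
  using assms by (intro integral_nonneg_AE AE_I2) (simp add: indicator_def)

lemma abs_set_integral_diff_le:
  fixes f h :: "'a \<Rightarrow> real"
  assumes "set_integrable M S f" "set_integrable M S h"
  shows "\<bar>(LINT x:S|M. f x) - (LINT x:S|M. h x)\<bar> \<le> (LINT x:S|M. \<bar>f x - h x\<bar>)"
  using set_integral_norm_bound[of M S "\<lambda>x. f x - h x"] assms by simp

lemma set_integrable_mult_bounded:
  fixes f u :: "'a \<Rightarrow> real"
  assumes f: "set_integrable M S f" and u: "set_borel_measurable M S u" and bound: "\<And>x. x \<in> S \<Longrightarrow> \<bar>u x\<bar> \<le> 1"
  shows "set_integrable M S (\<lambda>x. f x * u x)"
proof (rule set_integrable_bound[OF f])
  have "(\<lambda>x. (indicator S x *\<^sub>R f x) * (indicator S x *\<^sub>R u x)) \<in> borel_measurable M"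
    using f u unfolding set_integrable_def set_borel_measurable_def by (intro borel_measurable_times) auto
  also have "(\<lambda>x. (indicator S x *\<^sub>R f x) * (indicator S x *\<^sub>R u x)) = (\<lambda>x. indicator S x *\<^sub>R (f x * u x))"
    by (auto simp: indicator_def)
  finally show "set_borel_measurable M S (\<lambda>x. f x * u x)" by (simp add: set_borel_measurable_def)
qed (use bound in \<open>auto simp: abs_mult intro!: mult_left_le\<close>)

lemma abs_set_integral_mult_bounded_le:
  fixes f u :: "'a \<Rightarrow> real"
  assumes f: "set_integrable M S f" and u: "set_borel_measurable M S u" and bound: "\<And>x. x \<in> S \<Longrightarrow> \<bar>u x\<bar> \<le> 1"
  shows "\<bar>LINT x:S|M. f x * u x\<bar> \<le> (LINT x:S|M. \<bar>f x\<bar>)"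
proof -
  have integrable_product: "set_integrable M S (\<lambda>x. f x * u x)" by (rule set_integrable_mult_bounded[OF assms])
  have "\<bar>LINT x:S|M. f x * u x\<bar> \<le> (LINT x:S|M. \<bar>f x * u x\<bar>)"
    using set_integral_norm_bound[OF integrable_product] by simp
  also have "\<dots> \<le> (LINT x:S|M. \<bar>f x\<bar>)"
    using bound by (intro set_integral_mono set_integrable_abs integrable_product f)
      (auto simp: abs_mult intro!: mult_left_le)
  finally show ?thesis .
qed

lemma nonneg_has_integral_imp_lebesgue:
  fixes f :: "'a::euclidean_space \<Rightarrow> real"
  assumes "(f has_integral i) S" "\<And>x. x \<in> S \<Longrightarrow> 0 \<le> f x"
  shows "set_integrable lebesgue S f" "(LINT x:S|lebesgue. f x) = i"
proof -
  show integrable: "set_integrable lebesgue S f"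
    using assms by (intro nonnegative_absolutely_integrable_1) auto
  show "(LINT x:S|lebesgue. f x) = i"
    using set_lebesgue_integral_eq_integral(2)[OF integrable] assms(1) by (simp add: integral_unique)
qed

lemma cSUP_mult_left_real:
  fixes f :: "'a \<Rightarrow> real"
  assumes "A \<noteq> {}" "bdd_above (f ` A)" "0 \<le> c"
  shows "(SUP x\<in>A. c * f x) = c * (SUP x\<in>A. f x)"
proof -
  have "continuous (at_left (Sup (f ` A))) ((*) c)" by (intro continuous_intros)
  then show ?thesis
    using continuous_at_Sup_mono[of "(*) c" "f ` A"] assms
    by (simp add: mono_def mult_left_mono image_image)
qed

lemma cINF_mult_left_real:
  fixes f :: "'a \<Rightarrow> real"
  assumes "A \<noteq> {}" "bdd_below (f ` A)" "0 \<le> c"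
  shows "(INF x\<in>A. c * f x) = c * (INF x\<in>A. f x)"
proof -
  have "continuous (at_right (Inf (f ` A))) ((*) c)" by (intro continuous_intros)
  then show ?thesis
    using continuous_at_Inf_mono[of "(*) c" "f ` A"] assms
    by (simp add: mono_def mult_left_mono image_image)
qed

lemma powr_Bernoulli:
  fixes \<gamma> s :: real
  assumes "0 \<le> \<gamma>" "0 \<le> s" shows "1 - \<gamma> * s \<le> (1 + s) powr - \<gamma>"
proof -
  have "1 - \<gamma> * s \<le> 1 + (- \<gamma> * ln (1 + s))"
    using mult_left_mono[OF ln_add_one_self_le_self[OF assms(2)] assms(1)] by simp
  also have "\<dots> \<le> exp (- \<gamma> * ln (1 + s))" by (rule exp_ge_add_one_self)
  also have "\<dots> = (1 + s) powr - \<gamma>" using assms by (simp add: powr_def)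
  finally show ?thesis .
qed

lemma harm_over_n_tendsto_0: "(\<lambda>n. harm n / real n) \<longlonglongrightarrow> (0::real)"
proof -
  have "(\<lambda>n. (harm n - ln (real n)) / real n) \<longlonglongrightarrow> (0::real)"
    by (rule tendsto_divide_0[OF euler_mascheroni_LIMSEQ])
      (rule filterlim_at_top_imp_at_infinity[OF filterlim_real_sequentially])
  moreover have "(\<lambda>n. ln (real n) / real n) \<longlonglongrightarrow> 0" by real_asymp
  ultimately have "(\<lambda>n. (harm n - ln (real n)) / real n + ln (real n) / real n) \<longlonglongrightarrow> 0 + 0"
    by (rule tendsto_add)
  then show ?thesis by (simp add: add_divide_distrib[symmetric])
qed

lemma harm_sublinear:
  fixes K \<epsilon> :: real
  assumes "0 < \<epsilon>" shows "\<exists>n\<ge>1. K * harm n \<le> \<epsilon> * real n"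
proof -
  have "(\<lambda>n. K * (harm n / real n)) \<longlonglongrightarrow> 0"
    using tendsto_mult_right_zero[OF harm_over_n_tendsto_0] .
  then have "\<forall>\<^sub>F n in sequentially. K * (harm n / real n) < \<epsilon>"
    using assms by (rule order_tendstoD)
  with eventually_ge_at_top[of 1] have "\<forall>\<^sub>F n in sequentially. 1 \<le> n \<and> K * harm n \<le> \<epsilon> * real n"
    by eventually_elim (simp add: field_simps)
  then show ?thesis by (auto dest: eventually_happens)
qed

section \<open>Weights on the half-line\<close>

definition weight :: "(real \<Rightarrow> real) \<Rightarrow> bool" where
  "weight f \<longleftrightarrow> (\<forall>t\<ge>0. 0 \<le> f t) \<and> set_integrable lebesgue {0..} f"

abbreviation mass :: "(real \<Rightarrow> real) \<Rightarrow> real" where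
  "mass f \<equiv> (LINT t:{0..}|lebesgue. f t)"

definition shift :: "real \<Rightarrow> (real \<Rightarrow> real) \<Rightarrow> real \<Rightarrow> real" where
  "shift T f = (\<lambda>t. f (t + T))"

definition truncate :: "real \<Rightarrow> (real \<Rightarrow> real) \<Rightarrow> real \<Rightarrow> real" where
  "truncate T f = (\<lambda>t. indicator {0..T} t * f t)"

definition L1_dist :: "(real \<Rightarrow> real) \<Rightarrow> (real \<Rightarrow> real) \<Rightarrow> real" where
  "L1_dist f h = mass (\<lambda>t. \<bar>f t - h t\<bar>)"

lemma weight_nonneg: "weight f \<Longrightarrow> 0 \<le> t \<Longrightarrow> 0 \<le> f t"
  by (simp add: weight_def)

lemma weight_integrable: "weight f \<Longrightarrow> set_integrable lebesgue {0..} f"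
  by (simp add: weight_def)

lemma weight_set_integrable:
  "weight f \<Longrightarrow> S \<in> sets lebesgue \<Longrightarrow> S \<subseteq> {0..} \<Longrightarrow> set_integrable lebesgue S f"
  by (rule set_integrable_subset[OF weight_integrable])

lemma density_set_iff_weight: "f \<in> density_set \<longleftrightarrow> weight f \<and> mass f = 1"
  by (auto simp: density_set_def weight_def)

lemma mass_cong: "(\<And>t. 0 \<le> t \<Longrightarrow> f t = h t) \<Longrightarrow> mass f = mass h"
  by (intro set_lebesgue_integral_cong) auto

lemma weight_cong: "(\<And>t. 0 \<le> t \<Longrightarrow> f t = h t) \<Longrightarrow> weight f \<longleftrightarrow> weight h"
  using set_integrable_cong[of lebesgue lebesgue "{0..}" "{0..}" f h] by (auto simp: weight_def)

lemma weight_dominated: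
  assumes f: "weight f" and h: "set_borel_measurable lebesgue {0..} h"
    and bounds: "\<And>t. 0 \<le> t \<Longrightarrow> 0 \<le> h t" "\<And>t. 0 \<le> t \<Longrightarrow> h t \<le> f t"
  shows "weight h"
proof -
  have "set_integrable lebesgue {0..} h"
    using h by (rule set_integrable_bound[OF weight_integrable[OF f]]) (use bounds in force)
  then show ?thesis using bounds by (simp add: weight_def)
qed

lemma mass_nonneg: "weight f \<Longrightarrow> 0 \<le> mass f"
  by (intro set_integral_nonneg) (simp add: weight_nonneg)

lemma weight_cmult: "weight f \<Longrightarrow> 0 \<le> c \<Longrightarrow> weight (\<lambda>t. c * f t)"
  by (auto simp: weight_def)

lemma weight_abs_diff: "weight f \<Longrightarrow> weight h \<Longrightarrow> weight (\<lambda>t. \<bar>f t - h t\<bar>)"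
  by (simp add: weight_def set_integrable_abs set_integral_diff)

lemma weight_indicator:
  assumes "S \<in> lmeasurable" shows "weight (indicat_real S)"
proof -
  have "set_integrable lebesgue UNIV (indicat_real S)"
    using assms
    by (auto simp: set_integrable_def fmeasurable_def simp flip: infinity_ennreal_def
        intro!: integrable_real_indicator)
  then have "set_integrable lebesgue {0..} (indicat_real S)"
    by (rule set_integrable_subset) auto
  then show ?thesis by (simp add: weight_def)
qed

lemma mass_indicator_Icc: "0 \<le> T \<Longrightarrow> mass (indicat_real {0..T}) = T"
  by (simp add: set_lebesgue_integral_def flip: indicator_inter_arith)

lemma uniform_dens_in_density_set: "0 < T \<Longrightarrow> uniform_dens T \<in> density_set"
  using weight_cmult[OF weight_indicator[of "{0..T}"], of "1 / T"]
  by (simp add: density_set_iff_weight uniform_dens_def mass_indicator_Icc)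

lemma weight_density_cases:
  assumes f: "weight f"
  obtains (null) "mass f = 0" | (scaled) c \<rho> where "0 < c" "\<rho> \<in> density_set" "f = (\<lambda>t. c * \<rho> t)"
proof (cases "mass f = 0")
  case False
  then have pos: "0 < mass f" using mass_nonneg[OF f] by simp
  then have "(\<lambda>t. 1 / mass f * f t) \<in> density_set"
    using weight_cmult[OF f, of "1 / mass f"] by (simp add: density_set_iff_weight)
  with pos show ?thesis by (intro that(2)[of "mass f" "\<lambda>t. 1 / mass f * f t"]) auto
qed (rule that(1))

subsection \<open>Shifts, truncations and scalings\<close>

lemma set_integrable_shift:
  assumes "set_integrable lebesgue {T..} f"
  shows "set_integrable lebesgue {0..} (shift T f)"
proof -
  have "integrable lebesgue (\<lambda>x. indicator {T..} (T + 1 * x) *\<^sub>R f (T + 1 * x))"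
    using assms unfolding set_integrable_def by (rule lebesgue_integrable_real_affine) simp
  moreover have "(\<lambda>x. indicator {T..} (T + 1 * x) *\<^sub>R f (T + 1 * x)) = (\<lambda>x. indicator {0..} x *\<^sub>R shift T f x)"
    by (auto simp: shift_def indicator_def add.commute)
  ultimately show ?thesis by (simp add: set_integrable_def)
qed

lemma mass_shift: "mass (shift T f) = (LINT t:{T..}|lebesgue. f t)"
proof -
  have "(LINT t:{T..}|lebesgue. f t) = (\<integral>x. indicator {T..} (T + 1 * x) *\<^sub>R f (T + 1 * x) \<partial>lebesgue)"
    unfolding set_lebesgue_integral_def by (subst lebesgue_integral_real_affine[of 1 _ T]) auto
  also have "(\<lambda>x. indicator {T..} (T + 1 * x) *\<^sub>R f (T + 1 * x)) = (\<lambda>x. indicator {0..} x *\<^sub>R shift T f x)"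
    by (auto simp: shift_def indicator_def add.commute)
  finally show ?thesis by (simp add: set_lebesgue_integral_def)
qed

lemma rho_shift_eq: "rho_shift \<rho> T t = shift T \<rho> t / mass (shift T \<rho>)"
  by (simp only: rho_shift_def mass_shift) (simp add: shift_def)

lemma weight_shift: "weight f \<Longrightarrow> 0 \<le> T \<Longrightarrow> weight (shift T f)"
  using set_integrable_shift[OF weight_set_integrable[of f "{T..}"]]
  by (auto simp: weight_def shift_def)

lemma mass_split:
  assumes f: "weight f" and T: "0 \<le> T"
  shows "mass f = (LINT t:{0..<T}|lebesgue. f t) + mass (shift T f)"
proof -
  have "(LINT t:{0..<T} \<union> {T..}|lebesgue. f t) = (LINT t:{0..<T}|lebesgue. f t) + (LINT t:{T..}|lebesgue. f t)"
    using T by (intro set_integral_Un weight_set_integrable[OF f]) auto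
  moreover have "{0..<T} \<union> {T..} = {0..}" using T by auto
  ultimately show ?thesis by (simp add: mass_shift)
qed

lemma mass_initially_const:
  assumes f: "weight f" and T: "0 \<le> T" and const: "\<And>t. 0 \<le> t \<Longrightarrow> t < T \<Longrightarrow> f t = a"
  shows "mass f = a * T + mass (shift T f)"
proof -
  have "(LINT t:{0..<T}|lebesgue. f t) = (LINT t:{0..<T}|lebesgue. a)"
    using const by (intro set_lebesgue_integral_cong) auto
  then show ?thesis using mass_split[OF f T] T by (simp add: set_lebesgue_integral_def)
qed

lemma mass_shift_le:
  assumes "weight f" "0 \<le> T" shows "mass (shift T f) \<le> mass f"
proof -
  have "0 \<le> (LINT t:{0..<T}|lebesgue. f t)"
    using assms by (intro set_integral_nonneg) (simp add: weight_nonneg)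
  with mass_split[OF assms] show ?thesis by simp
qed

lemma weight_truncate:
  assumes "weight f" shows "weight (truncate T f)"
proof (rule weight_dominated[OF assms])
  have "(\<lambda>t. indicator {0..T} t * (indicator {0..} t *\<^sub>R f t)) \<in> borel_measurable lebesgue"
    using weight_integrable[OF assms] unfolding set_integrable_def
    by (intro borel_measurable_times borel_measurable_indicator) auto
  then show "set_borel_measurable lebesgue {0..} (truncate T f)"
    by (simp add: set_borel_measurable_def truncate_def mult.left_commute)
qed (use assms in \<open>auto simp: truncate_def indicator_def weight_nonneg\<close>)

lemma mass_truncate_le: "weight f \<Longrightarrow> mass (truncate T f) \<le> mass f"
  by (intro set_integral_mono weight_integrable weight_truncate)
    (auto simp: truncate_def indicator_def weight_nonneg)

lemma set_integrable_scale:
  fixes f :: "real \<Rightarrow> real"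
  assumes "set_integrable lebesgue {0..} f" "0 < c"
  shows "set_integrable lebesgue {0..} (\<lambda>t. f (c * t))"
proof -
  have "integrable lebesgue (\<lambda>x. indicator {0..} (0 + c * x) *\<^sub>R f (0 + c * x))"
    using assms unfolding set_integrable_def by (intro lebesgue_integrable_real_affine) auto
  moreover have "(\<lambda>x. indicator {0..} (0 + c * x) *\<^sub>R f (0 + c * x)) = (\<lambda>x. indicator {0..} x *\<^sub>R f (c * x))"
    using assms by (auto simp: indicator_def zero_le_mult_iff)
  ultimately show ?thesis by (simp add: set_integrable_def)
qed

lemma weight_rho_scale: "weight f \<Longrightarrow> 0 < c \<Longrightarrow> weight (rho_scale f c)"
  by (auto simp: weight_def rho_scale_def intro: set_integrable_scale)

lemma mass_rho_scale:
  assumes "0 < c" shows "mass (rho_scale f c) = mass f"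
proof -
  have "mass f = c * (\<integral>x. indicator {0..} (0 + c * x) *\<^sub>R f (0 + c * x) \<partial>lebesgue)"
    unfolding set_lebesgue_integral_def using assms
    by (subst lebesgue_integral_real_affine[of c _ 0]) auto
  also have "(\<lambda>x. indicator {0..} (0 + c * x) *\<^sub>R f (0 + c * x)) = (\<lambda>x. indicator {0..} x *\<^sub>R f (c * x))"
    using assms by (auto simp: indicator_def zero_le_mult_iff)
  finally show ?thesis by (simp add: set_lebesgue_integral_def rho_scale_def)
qed

lemma rho_scale_in_density_set: "f \<in> density_set \<Longrightarrow> 0 < c \<Longrightarrow> rho_scale f c \<in> density_set"
  by (simp add: density_set_iff_weight weight_rho_scale mass_rho_scale)

subsection \<open>The distance in the mean\<close>

lemma L1_dist_commute: "L1_dist f h = L1_dist h f"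
  by (simp add: L1_dist_def abs_minus_commute)

lemma L1_dist_eq_0: "(\<And>t. 0 \<le> t \<Longrightarrow> f t = h t) \<Longrightarrow> L1_dist f h = 0"
  using mass_cong[of "\<lambda>t. \<bar>f t - h t\<bar>" "\<lambda>t. 0"] by (simp add: L1_dist_def)

lemma L1_dist_zero: "weight f \<Longrightarrow> L1_dist f (\<lambda>t. 0) = mass f"
  unfolding L1_dist_def by (rule mass_cong) (simp add: weight_nonneg)

lemma L1_dist_triangle:
  assumes "weight f" "weight h" "weight k"
  shows "L1_dist f k \<le> L1_dist f h + L1_dist h k"
proof -
  have "mass (\<lambda>t. \<bar>f t - k t\<bar>) \<le> mass (\<lambda>t. \<bar>f t - h t\<bar> + \<bar>h t - k t\<bar>)"
    using assms by (intro set_integral_mono set_integral_add weight_integrable weight_abs_diff) auto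
  also have "\<dots> = mass (\<lambda>t. \<bar>f t - h t\<bar>) + mass (\<lambda>t. \<bar>h t - k t\<bar>)"
    using assms by (intro set_integral_add weight_integrable weight_abs_diff)
  finally show ?thesis by (simp add: L1_dist_def)
qed

lemma L1_dist_eq_mass_diff:
  assumes "weight f" "weight h" "\<And>t. 0 \<le> t \<Longrightarrow> h t \<le> f t"
  shows "L1_dist f h = mass f - mass h"
proof -
  have "L1_dist f h = mass (\<lambda>t. f t - h t)"
    unfolding L1_dist_def using assms(3) by (intro mass_cong) simp
  then show ?thesis using assms by (simp add: weight_def)
qed

lemma L1_dist_le_if_uniformly_close:
  assumes "weight f" "weight h" "0 \<le> c" "0 \<le> T"
    and close: "\<And>t. 0 \<le> t \<Longrightarrow> \<bar>f t - h t\<bar> \<le> c * indicat_real {0..T} t"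
  shows "L1_dist f h \<le> c * T"
proof -
  have "L1_dist f h \<le> mass (\<lambda>t. c * indicat_real {0..T} t)"
    unfolding L1_dist_def using assms
    by (intro set_integral_mono weight_integrable weight_abs_diff weight_cmult weight_indicator) auto
  also have "\<dots> = c * T" using assms(4) by (simp add: mass_indicator_Icc)
  finally show ?thesis .
qed

lemma abs_mass_diff_le_L1_dist:
  "weight f \<Longrightarrow> weight h \<Longrightarrow> \<bar>mass f - mass h\<bar> \<le> L1_dist f h"
  unfolding L1_dist_def by (intro abs_set_integral_diff_le weight_integrable)

lemma L1_dist_rho_scale:
  assumes "0 < c" shows "L1_dist (rho_scale f c) (rho_scale h c) = L1_dist f h"
proof -
  have "L1_dist (rho_scale f c) (rho_scale h c) = mass (rho_scale (\<lambda>t. \<bar>f t - h t\<bar>) c)"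
    using assms by (simp add: L1_dist_def rho_scale_def abs_mult_pos' flip: right_diff_distrib)
  then show ?thesis using assms by (simp add: mass_rho_scale L1_dist_def)
qed

lemma L1_dist_dominated_convergence:
  assumes weights: "\<And>n. weight (f n)" "weight h" "weight w"
    and bound: "\<And>n t. 0 \<le> t \<Longrightarrow> \<bar>f n t - h t\<bar> \<le> w t"
    and lim: "AE t in lebesgue. 0 \<le> t \<longrightarrow> (\<lambda>n. f n t) \<longlonglongrightarrow> h t"
  shows "(\<lambda>n. L1_dist (f n) h) \<longlonglongrightarrow> 0"
proof -
  have "(\<lambda>n. L1_dist (f n) h) \<longlonglongrightarrow> integral\<^sup>L lebesgue (\<lambda>t::real. 0)"
    unfolding L1_dist_def set_lebesgue_integral_def
  proof (rule integral_dominated_convergence)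
    show "integrable lebesgue (\<lambda>t. indicator {0..} t *\<^sub>R w t)"
      using weight_integrable[OF weights(3)] by (simp add: set_integrable_def)
    show "(\<lambda>t. indicator {0..} t *\<^sub>R \<bar>f n t - h t\<bar>) \<in> borel_measurable lebesgue" for n
      using weight_integrable[OF weight_abs_diff[OF weights(1,2)]] by (auto simp: set_integrable_def)
    show "AE t in lebesgue. norm (indicator {0..} t *\<^sub>R \<bar>f n t - h t\<bar>) \<le> indicator {0..} t *\<^sub>R w t" for n
      using bound by (simp add: indicator_def)
    show "AE t in lebesgue. (\<lambda>n. indicator {0..} t *\<^sub>R \<bar>f n t - h t\<bar>) \<longlonglongrightarrow> 0"
      using lim
    proof eventually_elim
      case (elim t)
      then show ?case
        using tendsto_rabs_zero[OF LIM_zero[of "\<lambda>n. f n t" "h t"]] by (cases "0 \<le> t") auto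
    qed
  qed simp
  then show ?thesis by simp
qed

section \<open>Approximation by step functions\<close>

lemma weight_truncate_min:
  assumes f: "weight f" and B: "0 \<le> B"
  shows "weight (truncate B (\<lambda>t. min (f t) B))"
proof (intro weight_truncate weight_dominated[OF f])
  have "(\<lambda>t. min (indicator {0..} t *\<^sub>R f t) B) \<in> borel_measurable lebesgue"
    using weight_integrable[OF f] unfolding set_integrable_def
    by (intro borel_measurable_min) auto
  also have "(\<lambda>t. min (indicator {0..} t *\<^sub>R f t) B) = (\<lambda>t. indicator {0..} t *\<^sub>R min (f t) B)"
    using B by (auto simp: indicator_def)
  finally show "set_borel_measurable lebesgue {0..} (\<lambda>t. min (f t) B)"
    by (simp add: set_borel_measurable_def)
qed (use B in \<open>auto simp: weight_nonneg[OF f]\<close>)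

lemma weight_bounded_approximation:
  assumes f: "weight f" and \<epsilon>: "0 < \<epsilon>"
  obtains B where "0 < B" "L1_dist f (truncate B (\<lambda>t. min (f t) B)) < \<epsilon>"
proof -
  define h where "h n = truncate (real n) (\<lambda>t. min (f t) (real n))" for n
  have "(\<lambda>n. L1_dist (h n) f) \<longlonglongrightarrow> 0"
  proof (rule L1_dist_dominated_convergence[OF _ f f])
    show "weight (h n)" for n
      unfolding h_def by (rule weight_truncate_min[OF f]) simp
    show "\<bar>h n t - f t\<bar> \<le> f t" if "0 \<le> t" for n t
      using weight_nonneg[OF f that] by (simp add: h_def truncate_def indicator_def)
    have "(\<lambda>n. h n t) \<longlonglongrightarrow> f t" if "0 \<le> t" for t
    proof (rule tendsto_eventually)
      have "\<forall>\<^sub>F n in sequentially. t \<le> real n \<and> f t \<le> real n"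
        by (intro eventually_conj) real_asymp+
      then show "\<forall>\<^sub>F n in sequentially. h n t = f t"
        by eventually_elim (use that in \<open>simp add: h_def truncate_def\<close>)
    qed
    then show "AE t in lebesgue. 0 \<le> t \<longrightarrow> (\<lambda>n. h n t) \<longlonglongrightarrow> f t" by simp
  qed
  then have "\<forall>\<^sub>F n in sequentially. L1_dist (h n) f < \<epsilon>"
    using \<epsilon> by (rule order_tendstoD)
  with eventually_gt_at_top[of 0] have "\<forall>\<^sub>F n in sequentially. 0 < n \<and> L1_dist (h n) f < \<epsilon>"
    by (rule eventually_conj)
  then obtain n where "0 < n" "L1_dist (h n) f < \<epsilon>"
    by (auto dest: eventually_happens)
  with that[of "real n"] show ?thesis by (simp add: h_def L1_dist_commute)
qed

lemma weight_AE_limit_of_continuous: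
  assumes "weight f"
  obtains g :: "nat \<Rightarrow> real \<Rightarrow> real" where "\<And>n. continuous_on UNIV (g n)"
    "AE t in lebesgue. 0 \<le> t \<longrightarrow> (\<lambda>n. g n t) \<longlonglongrightarrow> f t"
proof -
  have "(\<lambda>t. indicator {0..} t *\<^sub>R f t) \<in> borel_measurable lebesgue"
    using weight_integrable[OF assms] by (auto simp: set_integrable_def)
  then have "(\<lambda>t. indicator {0..} t *\<^sub>R f t) measurable_on UNIV"
    by (rule lebesgue_measurable_imp_measurable_on) simp
  then obtain N g where N: "negligible N" and g: "\<And>n. continuous_on UNIV (g n)"
    and lim: "\<And>t. t \<notin> N \<Longrightarrow> (\<lambda>n. g n t) \<longlonglongrightarrow> indicator {0..} t *\<^sub>R f t"
    unfolding measurable_on_def by auto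
  have "AE t in lebesgue. t \<notin> N"
    using N unfolding negligible_iff_null_sets by (rule AE_not_in)
  then have "AE t in lebesgue. 0 \<le> t \<longrightarrow> (\<lambda>n. g n t) \<longlonglongrightarrow> f t"
  proof eventually_elim
    case (elim t)
    then show ?case using lim[of t] by (cases "0 \<le> t") auto
  qed
  with g show ?thesis by (rule that)
qed

lemma weight_if_continuous_bounded_support:
  assumes g: "continuous_on UNIV g" and bounds: "\<And>t. 0 \<le> g t" "\<And>t. g t \<le> B" and support: "\<And>t. b < t \<Longrightarrow> g t = 0"
  shows "weight g"
proof (rule weight_dominated)
  show "weight (\<lambda>t. B * indicat_real {0..b} t)"
    using order_trans[OF bounds] by (intro weight_cmult weight_indicator) auto
  show "set_borel_measurable lebesgue {0..} g"
    unfolding set_borel_measurable_def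
    using borel_measurable_continuous_onI[OF g]
    by (intro borel_measurable_scaleR borel_measurable_indicator measurable_completion) auto
  show "g t \<le> B * indicat_real {0..b} t" if "0 \<le> t" for t
    using that bounds[of t] support[of t] by (auto simp: indicator_def)
qed (rule bounds)

lemma bounded_weight_AE_limit_of_continuous:
  assumes f: "weight f" and B: "0 < B" and bound: "\<And>t. 0 \<le> t \<Longrightarrow> f t \<le> B"
    and support: "\<And>t. B < t \<Longrightarrow> f t = 0"
  obtains g :: "nat \<Rightarrow> real \<Rightarrow> real" where "\<And>n. continuous_on UNIV (g n)"
    "\<And>n t. 0 \<le> g n t" "\<And>n t. g n t \<le> B" "\<And>n t. B + 1 < t \<Longrightarrow> g n t = 0"
    "AE t in lebesgue. 0 \<le> t \<longrightarrow> (\<lambda>n. g n t) \<longlonglongrightarrow> f t"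
proof -
  obtain u :: "nat \<Rightarrow> real \<Rightarrow> real" where cont: "\<And>n. continuous_on UNIV (u n)"
    and lim: "AE t in lebesgue. 0 \<le> t \<longrightarrow> (\<lambda>n. u n t) \<longlonglongrightarrow> f t"
    by (rule weight_AE_limit_of_continuous[OF f]) (rule that)
  define cutoff where "cutoff t = max 0 (min 1 (B + 1 - t))" for t
  define g where "g n t = max 0 (min B (u n t)) * cutoff t" for n t
  have "AE t in lebesgue. 0 \<le> t \<longrightarrow> (\<lambda>n. g n t) \<longlonglongrightarrow> f t"
    using lim
  proof eventually_elim
    case (elim t)
    have "(\<lambda>n. g n t) \<longlonglongrightarrow> max 0 (min B (f t)) * cutoff t" if "0 \<le> t"
      unfolding g_def using elim that by (intro tendsto_intros) auto
    moreover have "max 0 (min B (f t)) * cutoff t = f t" if "0 \<le> t"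
      using weight_nonneg[OF f that] bound[OF that] support[of t] by (auto simp: cutoff_def)
    ultimately show ?case by simp
  qed
  moreover have "continuous_on UNIV (g n)" for n
    unfolding g_def cutoff_def by (intro continuous_intros cont)
  moreover have "0 \<le> g n t" "g n t \<le> B" for n t
    using mult_mono[of "max 0 (min B (u n t))" B "cutoff t" 1] B by (auto simp: g_def cutoff_def)
  moreover have "g n t = 0" if "B + 1 < t" for n t
    using that by (simp add: g_def cutoff_def)
  ultimately show ?thesis by (intro that[of g])
qed

lemma bounded_weight_continuous_approximation:
  assumes f: "weight f" and B: "0 < B" and bound: "\<And>t. 0 \<le> t \<Longrightarrow> f t \<le> B"
    and support: "\<And>t. B < t \<Longrightarrow> f t = 0" and \<epsilon>: "0 < \<epsilon>"
  obtains g where "continuous_on UNIV g" "weight g" "\<And>t. B + 1 < t \<Longrightarrow> g t = 0" "L1_dist f g < \<epsilon>"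
proof -
  obtain g :: "nat \<Rightarrow> real \<Rightarrow> real" where cont: "\<And>n. continuous_on UNIV (g n)"
    and range_g: "\<And>n t. 0 \<le> g n t" "\<And>n t. g n t \<le> B" and support_g: "\<And>n t. B + 1 < t \<Longrightarrow> g n t = 0"
    and lim: "AE t in lebesgue. 0 \<le> t \<longrightarrow> (\<lambda>n. g n t) \<longlonglongrightarrow> f t"
    by (rule bounded_weight_AE_limit_of_continuous[OF f B bound support]) (assumption | rule that)+
  have weight_g: "weight (g n)" for n
    by (rule weight_if_continuous_bounded_support[OF cont range_g support_g])
  have "(\<lambda>n. L1_dist (g n) f) \<longlonglongrightarrow> 0"
  proof (rule L1_dist_dominated_convergence[OF weight_g f _ _ lim])
    show "weight (\<lambda>t. B * indicat_real {0..B + 1} t)"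
      using B by (intro weight_cmult weight_indicator) auto
    show "\<bar>g n t - f t\<bar> \<le> B * indicat_real {0..B + 1} t" if "0 \<le> t" for n t
      using range_g[of n t] weight_nonneg[OF f that] bound[OF that] support[of t] support_g[of t n] that
      by (cases "t \<le> B + 1") (auto simp: abs_le_iff)
  qed
  then have "\<forall>\<^sub>F n in sequentially. L1_dist (g n) f < \<epsilon>"
    using \<epsilon> by (rule order_tendstoD)
  then obtain n where "L1_dist f (g n) < \<epsilon>"
    by (auto simp: L1_dist_commute dest: eventually_happens)
  then show ?thesis using that[of "g n", OF cont weight_g support_g] by blast
qed

lemma weight_continuous_approximation:
  assumes f: "weight f" and \<epsilon>: "0 < \<epsilon>"
  obtains g b where "continuous_on UNIV g" "weight g" "0 < b" "\<And>t. b < t \<Longrightarrow> g t = 0" "L1_dist f g < \<epsilon>"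
proof -
  obtain B where B: "0 < B" and close: "L1_dist f (truncate B (\<lambda>t. min (f t) B)) < \<epsilon> / 2"
    using weight_bounded_approximation[OF f, of "\<epsilon> / 2"] \<epsilon> by auto
  define h where "h = truncate B (\<lambda>t. min (f t) B)"
  have h: "weight h" unfolding h_def using B by (intro weight_truncate_min f) simp
  have bound: "h t \<le> B" and support: "B < t \<Longrightarrow> h t = 0" for t
    using B by (auto simp: h_def truncate_def indicator_def)
  obtain g where g: "continuous_on UNIV g" "weight g" "\<And>t. B + 1 < t \<Longrightarrow> g t = 0" "L1_dist h g < \<epsilon> / 2"
    by (rule bounded_weight_continuous_approximation[OF h B bound support half_gt_zero[OF \<epsilon>]])
      (assumption | rule that)+
  have "L1_dist f g < \<epsilon>"
    using L1_dist_triangle[OF f h g(2)] close g(4) by (simp add: h_def)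
  with that[of g "B + 1"] g B show ?thesis by simp
qed

definition step_heights :: "(nat \<Rightarrow> real) \<Rightarrow> nat \<Rightarrow> bool" where
  "step_heights a n \<longleftrightarrow> (\<forall>i<n. 0 < a i) \<and> (\<forall>i\<ge>n. a i = 0)"

definition step_fun :: "(nat \<Rightarrow> real) \<Rightarrow> real \<Rightarrow> real \<Rightarrow> real" where
  "step_fun a \<delta> t = a (nat \<lfloor>t / \<delta>\<rfloor>)"

lemma step_fun_eq:
  assumes "0 < \<delta>" "real i * \<delta> \<le> t" "t < real (Suc i) * \<delta>"
  shows "step_fun a \<delta> t = a i"
proof -
  have "\<lfloor>t / \<delta>\<rfloor> = int i"
    using assms by (intro floor_unique) (auto simp: field_simps)
  then show ?thesis by (simp add: step_fun_def)
qed

lemma step_fun_beyond: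
  assumes "0 < \<delta>" "step_heights a n" "real n * \<delta> \<le> t"
  shows "step_fun a \<delta> t = 0"
proof -
  have "real n \<le> t / \<delta>" using assms by (simp add: field_simps)
  then have "n \<le> nat \<lfloor>t / \<delta>\<rfloor>" by (simp add: le_nat_floor)
  then show ?thesis using assms(2) by (simp add: step_fun_def step_heights_def)
qed

lemma shift_step_fun:
  assumes "0 < \<delta>" "0 \<le> t" shows "shift \<delta> (step_fun a \<delta>) t = step_fun (\<lambda>i. a (Suc i)) \<delta> t"
proof -
  have "(t + \<delta>) / \<delta> = t / \<delta> + 1" using assms by (simp add: field_simps)
  moreover have "0 \<le> \<lfloor>t / \<delta>\<rfloor>" using assms by simp
  ultimately show ?thesis by (simp add: shift_def step_fun_def nat_add_distrib)
qed

lemma rho_scale_step_fun: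
  "0 < c \<Longrightarrow> rho_scale (step_fun a (c * \<delta>)) c = step_fun (\<lambda>i. c * a i) \<delta>"
  by (simp add: rho_scale_def step_fun_def fun_eq_iff)

lemma weight_step_fun:
  assumes \<delta>: "0 < \<delta>" and a: "step_heights a n"
  shows "weight (step_fun a \<delta>)"
proof (rule weight_dominated)
  define B where "B = (\<Sum>i<n. a i)"
  have nonneg: "0 \<le> a i" for i
    using a by (cases "i < n") (auto simp: step_heights_def less_imp_le)
  have le: "a i \<le> B" for i
    using a nonneg member_le_sum[of i "{..<n}" a] unfolding B_def step_heights_def
    by (cases "i < n") (auto intro: sum_nonneg)
  show "weight (\<lambda>t. B * indicat_real {0..real n * \<delta>} t)"
    using nonneg by (intro weight_cmult weight_indicator) (auto simp: B_def intro: sum_nonneg)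
  have "step_fun a \<delta> \<in> borel_measurable borel"
    unfolding step_fun_def[abs_def] by measurable
  then show "set_borel_measurable lebesgue {0..} (step_fun a \<delta>)"
    unfolding set_borel_measurable_def
    by (intro borel_measurable_scaleR borel_measurable_indicator measurable_completion) auto
  fix t :: real assume t: "0 \<le> t"
  show "0 \<le> step_fun a \<delta> t" by (simp add: step_fun_def nonneg)
  show "step_fun a \<delta> t \<le> B * indicat_real {0..real n * \<delta>} t"
    using t le step_fun_beyond[OF \<delta> a, of t]
    by (cases "t \<le> real n * \<delta>") (auto simp: step_fun_def)
qed

lemma uniform_step_approximation:
  assumes \<delta>: "0 < \<delta>" and b: "0 \<le> b" and \<eta>: "0 < \<eta>"
    and nonneg: "\<And>t. 0 \<le> t \<Longrightarrow> 0 \<le> g t" and support: "\<And>t. b < t \<Longrightarrow> g t = 0"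
    and oscillation: "\<And>s t. 0 \<le> s \<Longrightarrow> s \<le> t \<Longrightarrow> t \<le> s + \<delta> \<Longrightarrow> t \<le> b + \<delta> \<Longrightarrow> \<bar>g t - g s\<bar> \<le> \<eta>"
  obtains a n where "step_heights a n" "real n * \<delta> \<le> b + \<delta>"
    "\<And>t. 0 \<le> t \<Longrightarrow> \<bar>g t - step_fun a \<delta> t\<bar> \<le> 2 * \<eta> * indicat_real {0..b + \<delta>} t"
proof -
  define n where "n = nat \<lfloor>b / \<delta>\<rfloor> + 1"
  define a where "a i = (if i < n then g (real i * \<delta>) + \<eta> else 0)" for i
  have "real n \<le> b / \<delta> + 1" "b / \<delta> < real n"
    unfolding n_def using b \<delta> by (auto simp: of_nat_floor) linarith
  then have n: "real n * \<delta> \<le> b + \<delta>" "b < real n * \<delta>"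
    using \<delta> by (auto simp: field_simps)
  have a: "step_heights a n"
    using \<delta> \<eta> by (auto simp: step_heights_def a_def intro!: add_nonneg_pos nonneg)
  have "\<bar>g t - step_fun a \<delta> t\<bar> \<le> 2 * \<eta> * indicat_real {0..b + \<delta>} t" if t: "0 \<le> t" for t
  proof (cases "t < real n * \<delta>")
    case True
    define i where "i = nat \<lfloor>t / \<delta>\<rfloor>"
    have "real i \<le> t / \<delta>" "t / \<delta> < real i + 1"
      unfolding i_def using t \<delta> by (auto simp: of_nat_floor)
    then have i: "real i * \<delta> \<le> t" "t < (real i + 1) * \<delta>" using \<delta> by (auto simp: field_simps)
    with True have "real i * \<delta> < real n * \<delta>" by linarith
    then have "i < n" using \<delta> by simp
    moreover have "\<bar>g t - g (real i * \<delta>)\<bar> \<le> \<eta>"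
      using i True n \<delta> by (intro oscillation) (auto simp: distrib_right)
    ultimately show ?thesis
      using step_fun_eq[OF \<delta>, of i t a] i True n t by (simp add: a_def add.commute)
  next
    case False
    then show ?thesis
      using n \<eta> support[of t] step_fun_beyond[OF \<delta> a, of t] by simp
  qed
  with a n(1) show ?thesis by (rule that)
qed

definition step_approximable :: "(real \<Rightarrow> real) \<Rightarrow> real \<Rightarrow> real \<Rightarrow> real \<Rightarrow> bool" where
  "step_approximable f \<epsilon> b h \<longleftrightarrow> (\<forall>\<delta>. 0 < \<delta> \<and> \<delta> \<le> h \<longrightarrow>
    (\<exists>a n. step_heights a n \<and> real n * \<delta> \<le> b \<and> L1_dist f (step_fun a \<delta>) \<le> \<epsilon>))"

lemma weight_step_approximation:
  assumes f: "weight f" and \<epsilon>: "0 < \<epsilon>"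
  obtains b h where "0 < b" "0 < h" "step_approximable f \<epsilon> b h"
proof -
  obtain g b where cont: "continuous_on UNIV g" and weight_g: "weight g" and b: "0 < b"
    and support: "\<And>t. b < t \<Longrightarrow> g t = 0" and close: "L1_dist f g < \<epsilon> / 2"
    using weight_continuous_approximation[OF f, of "\<epsilon> / 2"] \<epsilon> by auto
  define \<eta> where "\<eta> = \<epsilon> / (4 * (b + 1))"
  have \<eta>: "0 < \<eta>" using \<epsilon> b by (simp add: \<eta>_def)
  have "uniformly_continuous_on {0..b + 1} g"
    by (intro compact_uniformly_continuous continuous_on_subset[OF cont]) auto
  then obtain h where h: "0 < h"
    and modulus: "\<And>s t. s \<in> {0..b + 1} \<Longrightarrow> t \<in> {0..b + 1} \<Longrightarrow> dist s t < h \<Longrightarrow> dist (g s) (g t) < \<eta>"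
    using \<eta> unfolding uniformly_continuous_on_def by metis
  have "step_approximable f \<epsilon> (b + 1) (min 1 (h / 2))"
    unfolding step_approximable_def
  proof (intro allI impI)
    fix \<delta> :: real assume "0 < \<delta> \<and> \<delta> \<le> min 1 (h / 2)"
    then have \<delta>: "0 < \<delta>" "\<delta> \<le> min 1 (h / 2)" by auto
    have oscillation: "\<bar>g t - g s\<bar> \<le> \<eta>" if "0 \<le> s" "s \<le> t" "t \<le> s + \<delta>" "t \<le> b + \<delta>" for s t
      using modulus[of t s] that \<delta> h by (simp add: dist_real_def)
    obtain a n where a: "step_heights a n" "real n * \<delta> \<le> b + \<delta>"
      and uniform: "\<And>t. 0 \<le> t \<Longrightarrow> \<bar>g t - step_fun a \<delta> t\<bar> \<le> 2 * \<eta> * indicat_real {0..b + \<delta>} t"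
      by (rule uniform_step_approximation[OF \<delta>(1) less_imp_le[OF b] \<eta> weight_nonneg[OF weight_g]
            support oscillation])
        (assumption | rule that)+
    have weight_step: "weight (step_fun a \<delta>)" by (rule weight_step_fun[OF \<delta>(1) a(1)])
    have "L1_dist g (step_fun a \<delta>) \<le> 2 * \<eta> * (b + \<delta>)"
      using \<eta> b \<delta> by (intro L1_dist_le_if_uniformly_close weight_g weight_step uniform) auto
    also have "\<dots> \<le> 2 * \<eta> * (b + 1)" using \<delta> \<eta> by (intro mult_left_mono) auto
    also have "\<dots> = \<epsilon> / 2" using b by (simp add: \<eta>_def field_simps)
    finally have "L1_dist f (step_fun a \<delta>) \<le> \<epsilon>"
      using L1_dist_triangle[OF f weight_g weight_step] close by linarith
    with a \<delta>(2) show "\<exists>a n. step_heights a n \<and> real n * \<delta> \<le> b + 1 \<and> L1_dist f (step_fun a \<delta>) \<le> \<epsilon>"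
      by (intro exI[of _ a] exI[of _ n]) auto
  qed
  with b h show ?thesis by (intro that[of "b + 1" "min 1 (h / 2)"]) auto
qed

section \<open>Self-similar densities\<close>

locale selfsimilar_density =
  fixes \<mu> :: "real \<Rightarrow> real" and C :: real
  assumes density: "\<mu> \<in> density_set"
    and initial_pos: "0 < \<mu> 0"
    and lipschitz_at_0: "0 \<le> t \<Longrightarrow> \<bar>\<mu> t - \<mu> 0\<bar> \<le> C * t"
    and similar: "0 < r \<Longrightarrow> \<exists>\<kappa> c. 0 < \<kappa> \<and> \<kappa> \<le> 1 \<and> (\<forall>t\<ge>0. \<mu> (t + r) = c * \<mu> (\<kappa> * t))"

lemma mass_shift_if_similar:
  assumes \<mu>: "\<mu> \<in> density_set" and \<kappa>: "0 < \<kappa>"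
    and similar: "\<And>t. 0 \<le> t \<Longrightarrow> \<mu> (t + r) = c * \<mu> (\<kappa> * t)"
  shows "mass (shift r \<mu>) = c / \<kappa>"
proof -
  have "mass (shift r \<mu>) = mass (\<lambda>t. c / \<kappa> * rho_scale \<mu> \<kappa> t)"
    using \<kappa> by (intro mass_cong) (simp add: shift_def rho_scale_def similar)
  also have "\<dots> = c / \<kappa>"
    using \<mu> \<kappa> by (simp add: mass_rho_scale density_set_iff_weight)
  finally show ?thesis .
qed

lemma rho_shift_eq_rho_scale_if_similar:
  assumes "\<mu> \<in> density_set" "0 < \<kappa>" "c \<noteq> 0"
    and similar: "\<And>t. 0 \<le> t \<Longrightarrow> \<mu> (t + r) = c * \<mu> (\<kappa> * t)" and "0 \<le> t"
  shows "rho_shift \<mu> r t = rho_scale \<mu> \<kappa> t"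
  using mass_shift_if_similar[OF assms(1,2) similar] assms
  by (simp add: rho_shift_eq rho_scale_def shift_def)

context selfsimilar_density
begin

lemma weight: "weight \<mu>" and mass: "mass \<mu> = 1"
  using density by (auto simp: density_set_iff_weight)

lemma shift_eq_scale:
  assumes "0 < r"
  obtains \<kappa> p where "0 < \<kappa>" "\<kappa> \<le> 1" "0 \<le> p" "p \<le> 1"
    "\<And>t. 0 \<le> t \<Longrightarrow> shift r \<mu> t = p * rho_scale \<mu> \<kappa> t"
proof -
  obtain \<kappa> c where \<kappa>: "0 < \<kappa>" "\<kappa> \<le> 1" and similar_r: "\<And>t. 0 \<le> t \<Longrightarrow> \<mu> (t + r) = c * \<mu> (\<kappa> * t)"
    using similar[OF assms] by blast
  have "mass (shift r \<mu>) = c / \<kappa>"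
    by (rule mass_shift_if_similar[OF density \<kappa>(1) similar_r])
  then have "0 \<le> c / \<kappa>" "c / \<kappa> \<le> 1"
    using mass_nonneg[OF weight_shift[OF weight, of r]] mass_shift_le[OF weight, of r] mass assms by auto
  then show ?thesis
    by (rule that[OF \<kappa>]) (use \<kappa> in \<open>simp add: shift_def rho_scale_def similar_r\<close>)
qed

lemma integral_rho_scale_diff_initial_le:
  assumes \<theta>: "0 < \<theta>" and T: "0 \<le> T"
  shows "(LINT t:{0..<T}|lebesgue. \<bar>rho_scale \<mu> \<theta> t - \<theta> * \<mu> 0\<bar>) \<le> C * (\<theta> * T)\<^sup>2"
proof -
  have const: "set_integrable lebesgue {0..<T} (\<lambda>t. x)" for x :: real
    using T by (auto simp: set_integrable_def emeasure_lborel_Ico intro!: integrable_real_indicator)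
  have C: "0 \<le> C" using lipschitz_at_0[of 1] by simp
  have "(LINT t:{0..<T}|lebesgue. \<bar>rho_scale \<mu> \<theta> t - \<theta> * \<mu> 0\<bar>) \<le> (LINT t:{0..<T}|lebesgue. \<theta> * (C * (\<theta> * T)))"
  proof (rule set_integral_mono)
    show "set_integrable lebesgue {0..<T} (\<lambda>t. \<bar>rho_scale \<mu> \<theta> t - \<theta> * \<mu> 0\<bar>)"
      by (intro set_integrable_abs set_integral_diff const weight_set_integrable weight_rho_scale weight \<theta>) auto
    fix t assume t: "t \<in> {0..<T}"
    have "\<bar>rho_scale \<mu> \<theta> t - \<theta> * \<mu> 0\<bar> = \<theta> * \<bar>\<mu> (\<theta> * t) - \<mu> 0\<bar>"
      using \<theta> by (simp add: rho_scale_def abs_mult flip: right_diff_distrib)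
    also have "\<dots> \<le> \<theta> * (C * (\<theta> * t))"
      using \<theta> t by (intro mult_left_mono lipschitz_at_0) auto
    also have "\<dots> \<le> \<theta> * (C * (\<theta> * T))"
      using \<theta> C t by (intro mult_left_mono) auto
    finally show "\<bar>rho_scale \<mu> \<theta> t - \<theta> * \<mu> 0\<bar> \<le> \<theta> * (C * (\<theta> * T))" .
  qed (rule const)
  also have "\<dots> = C * (\<theta> * T)\<^sup>2"
    using T by (simp add: set_lebesgue_integral_def power2_eq_square)
  finally show ?thesis .
qed

lemma integral_uniform_dens_diff_rho_scale_le:
  assumes "0 < T" "0 \<le> S" "S \<le> T"
  shows "(LINT t:{0..<S}|lebesgue. \<bar>uniform_dens T t - rho_scale \<mu> (1 / (\<mu> 0 * T)) t\<bar>)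
    \<le> C * (S / (\<mu> 0 * T))\<^sup>2"
proof -
  define \<theta> where "\<theta> = 1 / (\<mu> 0 * T)"
  have \<theta>: "0 < \<theta>" "\<theta> * \<mu> 0 = 1 / T" using assms(1) initial_pos by (auto simp: \<theta>_def)
  have "(LINT t:{0..<S}|lebesgue. \<bar>uniform_dens T t - rho_scale \<mu> \<theta> t\<bar>)
      = (LINT t:{0..<S}|lebesgue. \<bar>rho_scale \<mu> \<theta> t - \<theta> * \<mu> 0\<bar>)"
    using assms by (intro set_lebesgue_integral_cong) (auto simp: uniform_dens_def \<theta>(2) abs_minus_commute)
  also have "\<dots> \<le> C * (\<theta> * S)\<^sup>2"
    by (rule integral_rho_scale_diff_initial_le[OF \<theta>(1) assms(2)])
  finally show ?thesis by (simp add: \<theta>_def)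
qed

end

lemma exp_dens_in_density_set: "exp_dens 1 \<in> density_set"
  using nonneg_has_integral_imp_lebesgue[OF has_integral_exp_minus_to_infinity[of 1 0]]
  by (simp add: density_set_def exp_dens_def)

lemma exp_dens_piecewise_cont_pos: "piecewise_cont_pos (exp_dens 1)"
  unfolding piecewise_cont_pos_def exp_dens_def by (auto intro!: exI[of _ "{}"])

lemma rho_scale_exp_dens: "rho_scale (exp_dens 1) c = exp_dens c"
  by (simp add: rho_scale_def exp_dens_def)

lemma exp_dens_selfsimilar: "selfsimilar_density (exp_dens 1) 1"
proof
  show "\<bar>exp_dens 1 t - exp_dens 1 0\<bar> \<le> 1 * t" if "0 \<le> t" for t
    using that exp_ge_add_one_self[of "- t"] by (simp add: exp_dens_def)
  show "\<exists>\<kappa> c. 0 < \<kappa> \<and> \<kappa> \<le> 1 \<and> (\<forall>t\<ge>0. exp_dens 1 (t + r) = c * exp_dens 1 (\<kappa> * t))" for r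
    by (intro exI[of _ 1] exI[of _ "exp (- r)"]) (simp add: exp_dens_def flip: exp_add)
qed (simp_all add: exp_dens_in_density_set, simp add: exp_dens_def)

lemma power_density_exists: "\<exists>\<rho>. power_density \<rho>"
proof
  let ?\<rho> = "\<lambda>t::real. (1 + 1 * t) powr (- 2)"
  have "((\<lambda>t. t powr (- 2)) has_integral 1) {1::real..}"
    using has_integral_powr_to_inf[of "- 2" 1] by simp
  then have "set_integrable lebesgue {1..} (\<lambda>t::real. t powr (- 2))"
    and "(LINT t:{1..}|lebesgue. t powr (- 2)) = (1::real)"
    by (rule nonneg_has_integral_imp_lebesgue; simp)+
  then have "?\<rho> \<in> density_set"
    using set_integrable_shift[of 1 "\<lambda>t. t powr (- 2)"] mass_shift[of 1 "\<lambda>t. t powr (- 2)"]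
    by (simp add: density_set_def shift_def add.commute)
  then show "power_density ?\<rho>"
    unfolding power_density_def by (intro conjI exI[of _ 1] exI[of _ 2]) auto
qed

lemma powr_shift_eq_scale:
  fixes \<alpha> \<beta> \<gamma> T t :: real
  assumes "0 < \<alpha>" "0 < \<beta>" "0 \<le> T" "0 \<le> t"
  shows "(\<alpha> + \<beta> * (t + T)) powr - \<gamma>
    = (\<alpha> / (\<alpha> + \<beta> * T)) powr \<gamma> * (\<alpha> + \<beta> * (\<alpha> / (\<alpha> + \<beta> * T) * t)) powr - \<gamma>"
proof -
  define \<kappa> where "\<kappa> = \<alpha> / (\<alpha> + \<beta> * T)"
  have pos: "0 < \<alpha> + \<beta> * T" using assms by (simp add: add_pos_nonneg)
  then have \<kappa>: "0 < \<kappa>" using assms by (simp add: \<kappa>_def)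
  have "\<alpha> + \<beta> * (\<kappa> * t) = \<kappa> * (\<alpha> + \<beta> * (t + T))"
    using pos by (simp add: \<kappa>_def field_simps)
  then show ?thesis
    using \<kappa> assms unfolding \<kappa>_def[symmetric] by (simp add: powr_mult powr_minus add_pos_nonneg)
qed

lemma power_density_shift_eq_scale:
  assumes "power_density \<rho>"
  obtains \<alpha> \<beta> where "0 < \<alpha>" "0 < \<beta>"
    "\<And>T t. 0 \<le> T \<Longrightarrow> 0 \<le> t \<Longrightarrow> rho_shift \<rho> T t = rho_scale \<rho> (\<alpha> / (\<alpha> + \<beta> * T)) t"
proof -
  obtain \<alpha> \<beta> \<gamma> where \<rho>: "\<rho> \<in> density_set" and pos: "0 < \<alpha>" "0 < \<beta>"
    and \<rho>_eq: "\<And>t. 0 \<le> t \<Longrightarrow> \<rho> t = (\<alpha> + \<beta> * t) powr - \<gamma>"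
    using assms unfolding power_density_def by blast
  have "rho_shift \<rho> T t = rho_scale \<rho> (\<alpha> / (\<alpha> + \<beta> * T)) t" if "0 \<le> T" "0 \<le> t" for T t
  proof (rule rho_shift_eq_rho_scale_if_similar[OF \<rho> _ _ _ that(2)])
    show "0 < \<alpha> / (\<alpha> + \<beta> * T)" "(\<alpha> / (\<alpha> + \<beta> * T)) powr \<gamma> \<noteq> 0"
      using pos that by (auto simp: add_nonneg_eq_0_iff add_pos_nonneg)
    show "\<rho> (s + T) = (\<alpha> / (\<alpha> + \<beta> * T)) powr \<gamma> * \<rho> (\<alpha> / (\<alpha> + \<beta> * T) * s)" if "0 \<le> s" for s
      using powr_shift_eq_scale[OF pos \<open>0 \<le> T\<close> that] pos \<open>0 \<le> T\<close> that by (simp add: \<rho>_eq)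
  qed
  with pos show ?thesis by (rule that)
qed

lemma power_density_selfsimilar:
  assumes "power_density \<rho>"
  obtains C where "selfsimilar_density \<rho> C"
proof -
  obtain \<alpha> \<beta> \<gamma> where \<rho>: "\<rho> \<in> density_set" and pos: "0 < \<alpha>" "0 < \<beta>" "0 < \<gamma>"
    and \<rho>_eq: "\<And>t. 0 \<le> t \<Longrightarrow> \<rho> t = (\<alpha> + \<beta> * t) powr - \<gamma>"
    using assms unfolding power_density_def by blast
  have "selfsimilar_density \<rho> (\<alpha> powr - \<gamma> * (\<gamma> * (\<beta> / \<alpha>)))"
  proof
    show "\<bar>\<rho> t - \<rho> 0\<bar> \<le> \<alpha> powr - \<gamma> * (\<gamma> * (\<beta> / \<alpha>)) * t" if t: "0 \<le> t" for t
    proof -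
      define s where "s = \<beta> / \<alpha> * t"
      have s: "0 \<le> s" using pos t by (simp add: s_def)
      have "\<alpha> + \<beta> * t = \<alpha> * (1 + s)" using pos by (simp add: s_def field_simps)
      then have "\<rho> t - \<rho> 0 = \<alpha> powr - \<gamma> * ((1 + s) powr - \<gamma> - 1)"
        using pos s t by (simp add: \<rho>_eq powr_mult right_diff_distrib)
      moreover have "\<bar>(1 + s) powr - \<gamma> - 1\<bar> \<le> \<gamma> * s"
        using powr_Bernoulli[of \<gamma> s] powr_mono[of "- \<gamma>" 0 "1 + s"] pos s by simp
      ultimately have "\<bar>\<rho> t - \<rho> 0\<bar> \<le> \<alpha> powr - \<gamma> * (\<gamma> * s)"
        by (simp add: abs_mult mult_left_mono)
      then show ?thesis by (simp add: s_def mult.assoc)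
    qed
    show "\<exists>\<kappa> c. 0 < \<kappa> \<and> \<kappa> \<le> 1 \<and> (\<forall>t\<ge>0. \<rho> (t + r) = c * \<rho> (\<kappa> * t))" if "0 < r" for r
      using pos that
      by (intro exI[of _ "\<alpha> / (\<alpha> + \<beta> * r)"] exI[of _ "(\<alpha> / (\<alpha> + \<beta> * r)) powr \<gamma>"])
        (simp add: \<rho>_eq powr_shift_eq_scale add_pos_pos)
  qed (use \<rho> \<rho>_eq[of 0] pos in auto)
  then show ?thesis by (rule that)
qed

section \<open>Values of weights\<close>

locale weight_value =
  fixes V :: "(real \<Rightarrow> real) \<Rightarrow> 'w \<Rightarrow> real"
  assumes V_nonneg: "weight f \<Longrightarrow> 0 \<le> V f \<omega>"
    and V_cmult: "weight f \<Longrightarrow> 0 \<le> c \<Longrightarrow> V (\<lambda>t. c * f t) \<omega> = c * V f \<omega>"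
    and V_diff_le: "weight f \<Longrightarrow> weight h \<Longrightarrow> \<bar>V f \<omega> - V h \<omega>\<bar> \<le> L1_dist f h"
begin

lemma V_cong:
  assumes "weight f" "\<And>t. 0 \<le> t \<Longrightarrow> f t = h t" shows "V f \<omega> = V h \<omega>"
  using V_diff_le[of f h \<omega>] L1_dist_eq_0[of f h] weight_cong[of f h] assms by simp

lemma V_le_mass:
  assumes "weight f" shows "V f \<omega> \<le> mass f"
proof -
  have zero: "weight (\<lambda>t. 0)" using weight_cmult[OF assms, of 0] by simp
  have "V (\<lambda>t. 0) \<omega> = 0" using V_cmult[OF assms, of 0 \<omega>] by simp
  then show ?thesis
    using V_diff_le[OF assms zero, of \<omega>] L1_dist_zero[OF assms] by simp
qed

end

locale shift_comparable_value = weight_value V for V :: "(real \<Rightarrow> real) \<Rightarrow> 'w \<Rightarrow> real" +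
  assumes V_diff_le_shift: "weight f \<Longrightarrow> weight h \<Longrightarrow> 1 \<le> n
    \<Longrightarrow> (\<And>\<omega>. \<bar>V (shift (real n) f) \<omega> - V (shift (real n) h) \<omega>\<bar> \<le> d)
    \<Longrightarrow> \<bar>V f \<omega> - V h \<omega>\<bar> \<le> (LINT t:{0..<real n}|lebesgue. \<bar>f t - h t\<bar>) + d"

locale limit_candidate = shift_comparable_value V for V :: "(real \<Rightarrow> real) \<Rightarrow> 'w \<Rightarrow> real" +
  fixes U :: "'w \<Rightarrow> real"
  assumes U_range: "0 \<le> U \<omega> \<and> U \<omega> \<le> 1"
begin

definition deviation :: "(real \<Rightarrow> real) \<Rightarrow> 'w \<Rightarrow> real" where
  "deviation f \<omega> = \<bar>V f \<omega> - mass f * U \<omega>\<bar>"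

lemma deviation_cong:
  assumes "weight f" "\<And>t. 0 \<le> t \<Longrightarrow> f t = h t" shows "deviation f \<omega> = deviation h \<omega>"
  using V_cong[OF assms] mass_cong[of f h] assms by (simp add: deviation_def)

lemma deviation_cmult:
  "weight f \<Longrightarrow> 0 \<le> c \<Longrightarrow> deviation (\<lambda>t. c * f t) \<omega> = c * deviation f \<omega>"
  by (simp add: deviation_def V_cmult abs_mult_pos' right_diff_distrib mult.assoc)

lemma abs_mult_U_le: "\<bar>x * U \<omega>\<bar> \<le> \<bar>x\<bar>"
  using U_range[of \<omega>] by (simp add: abs_mult mult_left_le)

lemma deviation_le_mass:
  assumes "weight f" shows "deviation f \<omega> \<le> mass f"
proof -
  have "0 \<le> mass f * U \<omega>" using mass_nonneg[OF assms] U_range[of \<omega>] by simp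
  then show ?thesis
    using V_nonneg[OF assms, of \<omega>] V_le_mass[OF assms, of \<omega>] abs_mult_U_le[of "mass f" \<omega>] mass_nonneg[OF assms]
    unfolding deviation_def by linarith
qed

lemma deviation_diff_le:
  assumes "\<bar>V f \<omega> - V h \<omega>\<bar> \<le> d"
  shows "deviation f \<omega> \<le> deviation h \<omega> + d + \<bar>mass f - mass h\<bar>"
  using assms abs_mult_U_le[of "mass f - mass h" \<omega>] unfolding deviation_def left_diff_distrib by linarith

lemma deviation_le_L1_dist:
  assumes "weight f" "weight h"
  shows "deviation f \<omega> \<le> deviation h \<omega> + 2 * L1_dist f h"
  using deviation_diff_le[OF V_diff_le[OF assms, of \<omega>]] abs_mass_diff_le_L1_dist[OF assms] by linarith

lemma deviation_comparison:
  assumes f: "weight f" and h: "weight h" and mass: "mass f = mass h" and n: "1 \<le> n"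
    and tail_f: "\<And>\<omega>. deviation (shift (real n) f) \<omega> \<le> D"
    and tail_h: "\<And>\<omega>. deviation (shift (real n) h) \<omega> \<le> E"
  shows "deviation f \<omega> \<le> deviation h \<omega> + D + E + 2 * (LINT t:{0..<real n}|lebesgue. \<bar>f t - h t\<bar>)"
proof -
  let ?f = "shift (real n) f" and ?h = "shift (real n) h"
  define I where "I = (LINT t:{0..<real n}|lebesgue. \<bar>f t - h t\<bar>)"
  have "\<bar>mass ?f - mass ?h\<bar> = \<bar>(LINT t:{0..<real n}|lebesgue. f t) - (LINT t:{0..<real n}|lebesgue. h t)\<bar>"
    using mass_split[OF f, of "real n"] mass_split[OF h, of "real n"] mass by simp
  also have "\<dots> \<le> I"
    unfolding I_def by (intro abs_set_integral_diff_le weight_set_integrable f h) auto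
  finally have tail_masses: "\<bar>mass ?f - mass ?h\<bar> \<le> I" .
  have "\<bar>V ?f \<omega> - V ?h \<omega>\<bar> \<le> D + E + I" for \<omega>
    using tail_f[of \<omega>] tail_h[of \<omega>] abs_mult_U_le[of "mass ?f - mass ?h" \<omega>] tail_masses
    unfolding deviation_def left_diff_distrib by linarith
  then have "\<bar>V f \<omega> - V h \<omega>\<bar> \<le> I + (D + E + I)"
    unfolding I_def by (rule V_diff_le_shift[OF f h n])
  from deviation_diff_le[OF this] mass show ?thesis by (simp add: I_def)
qed

abbreviation interval_deviation :: "real \<Rightarrow> 'w \<Rightarrow> real" where
  "interval_deviation T \<equiv> deviation (indicat_real {0..T})"

definition cesaro_limit :: bool where
  "cesaro_limit \<longleftrightarrow> (\<forall>\<epsilon>>0. \<forall>\<^sub>F T in at_top. \<forall>\<omega>. interval_deviation T \<omega> \<le> \<epsilon> * T)"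

lemma interval_deviation_le: "0 \<le> T \<Longrightarrow> interval_deviation T \<omega> \<le> T"
  using deviation_le_mass[OF weight_indicator[of "{0..T}"]] by (simp add: mass_indicator_Icc)

lemma interval_deviation_extend:
  assumes "0 \<le> S" "S \<le> T"
  shows "interval_deviation T \<omega> \<le> interval_deviation S \<omega> + 2 * (T - S)"
proof -
  have "L1_dist (indicat_real {0..T}) (indicat_real {0..S}) = T - S"
    using assms by (subst L1_dist_eq_mass_diff)
      (auto simp: mass_indicator_Icc indicator_def intro!: weight_indicator)
  then show ?thesis
    using deviation_le_L1_dist[OF weight_indicator[of "{0..T}"] weight_indicator[of "{0..S}"]] by simp
qed

lemma cesaro_limit_if_multiples:
  assumes multiples: "\<And>\<epsilon>. 0 < \<epsilon> \<Longrightarrow>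
    \<exists>n\<ge>1. \<exists>N0. \<forall>N\<ge>N0. \<forall>\<omega>. interval_deviation (real n * real N) \<omega> \<le> \<epsilon> * (real n * real N)"
  shows cesaro_limit
  unfolding cesaro_limit_def
proof (intro allI impI)
  fix \<epsilon> :: real assume \<epsilon>: "0 < \<epsilon>"
  obtain n N0 where n: "1 \<le> n" and deviation:
    "\<And>N \<omega>. N0 \<le> N \<Longrightarrow> interval_deviation (real n * real N) \<omega> \<le> \<epsilon> / 2 * (real n * real N)"
    using multiples[OF half_gt_zero[OF \<epsilon>]] by blast
  show "\<forall>\<^sub>F T in at_top. \<forall>\<omega>. interval_deviation T \<omega> \<le> \<epsilon> * T"
    using eventually_ge_at_top[of "real n * (real N0 + 1)"] eventually_ge_at_top[of "4 * real n / \<epsilon>"]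
  proof eventually_elim
    case (elim T)
    define N where "N = nat \<lfloor>T / real n\<rfloor>"
    have "real N0 + 1 \<le> T / real n" using elim(1) n by (simp add: pos_le_divide_eq mult.commute)
    then have "N0 \<le> N" "real N \<le> T / real n" "T / real n \<le> real N + 1"
      unfolding N_def by linarith+
    then have N: "real n * real N \<le> T" "T \<le> real n * real N + real n"
      using n by (auto simp: field_simps)
    have "interval_deviation T \<omega> \<le> \<epsilon> / 2 * (real n * real N) + 2 * (T - real n * real N)" for \<omega>
      using interval_deviation_extend[OF _ N(1), of \<omega>] deviation[OF \<open>N0 \<le> N\<close>, of \<omega>] by simp
    moreover have "\<epsilon> / 2 * (real n * real N) \<le> \<epsilon> / 2 * T"
      using N(1) \<epsilon> by (intro mult_left_mono) auto
    moreover have "4 * real n \<le> \<epsilon> * T"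
      using elim(2) \<epsilon> by (simp add: pos_divide_le_eq mult.commute)
    ultimately have "interval_deviation T \<omega> \<le> \<epsilon> * T" for \<omega>
      using N(2) by (smt (verit) field_sum_of_halves distrib_right)
    then show ?case ..
  qed
qed

definition interval_deviation_bound :: "real \<Rightarrow> real \<Rightarrow> bool" where
  "interval_deviation_bound \<eta> T0 \<longleftrightarrow>
    0 \<le> \<eta> \<and> 0 \<le> T0 \<and> (\<forall>T\<ge>0. \<forall>\<omega>. interval_deviation T \<omega> \<le> \<eta> * T + T0)"

lemma interval_deviation_bound_if_cesaro:
  assumes cesaro_limit "0 < \<eta>"
  obtains T0 where "interval_deviation_bound \<eta> T0"
proof -
  obtain T1 where T1: "\<And>T \<omega>. T1 \<le> T \<Longrightarrow> interval_deviation T \<omega> \<le> \<eta> * T"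
    using assms unfolding cesaro_limit_def eventually_at_top_linorder by meson
  have "interval_deviation T \<omega> \<le> \<eta> * T + max T1 0" if "0 \<le> T" for T \<omega>
  proof (cases "T1 \<le> T")
    case True
    then show ?thesis using T1[of T \<omega>] by simp
  next
    case False
    then have "interval_deviation T \<omega> \<le> max T1 0"
      using interval_deviation_le[OF that, of \<omega>] by simp
    then show ?thesis using assms(2) that by (simp add: add_increasing)
  qed
  then show ?thesis using assms(2) by (intro that[of "max T1 0"]) (simp add: interval_deviation_bound_def)
qed

lemma deviation_uniform_dens:
  "0 < T \<Longrightarrow> deviation (uniform_dens T) \<omega> = interval_deviation T \<omega> / T"
  using deviation_cmult[OF weight_indicator[of "{0..T}"], of "1 / T"] by (simp add: uniform_dens_def)

lemma deviation_shift_uniform_dens: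
  assumes "0 < T" "0 \<le> S"
  shows "deviation (shift S (uniform_dens T)) \<omega> = interval_deviation (T - S) \<omega> / T"
proof -
  have "deviation (shift S (uniform_dens T)) \<omega> = deviation (\<lambda>t. 1 / T * indicat_real {0..T - S} t) \<omega>"
  proof (rule deviation_cong)
    show "weight (shift S (uniform_dens T))"
      using assms uniform_dens_in_density_set by (intro weight_shift) (auto simp: density_set_iff_weight)
  qed (use assms in \<open>auto simp: shift_def uniform_dens_def indicator_def\<close>)
  also have "\<dots> = 1 / T * interval_deviation (T - S) \<omega>"
    using assms by (intro deviation_cmult weight_indicator) auto
  finally show ?thesis by simp
qed

subsection \<open>From self-similar densities to uniform means\<close>

context
  fixes \<mu> :: "real \<Rightarrow> real" and C :: real
  assumes \<mu>: "selfsimilar_density \<mu> C"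
begin

interpretation selfsimilar_density \<mu> C by (rule \<mu>)

lemma deviation_shift_rho_scale_le:
  assumes \<theta>: "0 < \<theta>" and T: "0 < T"
    and scale: "\<And>\<theta>'. 0 < \<theta>' \<Longrightarrow> \<theta>' \<le> \<theta> \<Longrightarrow> deviation (rho_scale \<mu> \<theta>') \<omega> \<le> \<epsilon>"
  shows "deviation (shift T (rho_scale \<mu> \<theta>)) \<omega> \<le> \<epsilon>"
proof -
  obtain \<kappa> p where \<kappa>: "0 < \<kappa>" "\<kappa> \<le> 1" and p: "0 \<le> p" "p \<le> 1"
    and similar: "\<And>t. 0 \<le> t \<Longrightarrow> shift (\<theta> * T) \<mu> t = p * rho_scale \<mu> \<kappa> t"
    using shift_eq_scale[of "\<theta> * T"] \<theta> T by auto
  have "shift T (rho_scale \<mu> \<theta>) t = p * rho_scale \<mu> (\<kappa> * \<theta>) t" if "0 \<le> t" for t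
    using similar[of "\<theta> * t"] that \<theta> by (simp add: shift_def rho_scale_def distrib_left mult_ac)
  then have "deviation (shift T (rho_scale \<mu> \<theta>)) \<omega> = deviation (\<lambda>t. p * rho_scale \<mu> (\<kappa> * \<theta>) t) \<omega>"
    using \<theta> T by (intro deviation_cong weight_shift weight_rho_scale weight) auto
  also have "\<dots> = p * deviation (rho_scale \<mu> (\<kappa> * \<theta>)) \<omega>"
    using \<kappa> p \<theta> by (intro deviation_cmult weight_rho_scale weight) auto
  also have "\<dots> \<le> deviation (rho_scale \<mu> (\<kappa> * \<theta>)) \<omega>"
    using p by (simp add: mult_left_le_one_le deviation_def)
  also have "\<dots> \<le> \<epsilon>" using \<kappa> \<theta> by (intro scale) auto
  finally show ?thesis .
qed

lemma interval_deviation_step: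
  fixes k N :: nat
  assumes N: "1 \<le> N" and small: "1 / (\<mu> 0 * (real (Suc k) * real N)) < \<theta>0"
    and scale: "\<And>\<theta> \<omega>. 0 < \<theta> \<Longrightarrow> \<theta> < \<theta>0 \<Longrightarrow> deviation (rho_scale \<mu> \<theta>) \<omega> \<le> \<epsilon>"
    and previous: "\<And>\<omega>. interval_deviation (real k * real N) \<omega> \<le> D"
  shows "interval_deviation (real (Suc k) * real N) \<omega>
    \<le> D + real N * (2 * \<epsilon> * real (Suc k) + 2 * C / (\<mu> 0)\<^sup>2 / real (Suc k))"
proof -
  define T where "T = real (Suc k) * real N"
  define \<theta> where "\<theta> = 1 / (\<mu> 0 * T)"
  have T: "0 < T" "real N \<le> T" "T - real N = real k * real N"
    using N by (auto simp: T_def algebra_simps intro: add_pos_nonneg)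
  have \<theta>: "0 < \<theta>" "\<theta> < \<theta>0" using small T initial_pos by (auto simp: \<theta>_def T_def)
  have uniform: "weight (uniform_dens T)" "mass (uniform_dens T) = 1"
    using uniform_dens_in_density_set[OF T(1)] by (auto simp: density_set_iff_weight)
  have scaled: "weight (rho_scale \<mu> \<theta>)" "mass (rho_scale \<mu> \<theta>) = 1"
    using rho_scale_in_density_set[OF density \<theta>(1)] by (auto simp: density_set_iff_weight)
  have uniform_tail: "deviation (shift (real N) (uniform_dens T)) \<omega> \<le> D / T" for \<omega>
    using previous[of \<omega>] T by (simp add: deviation_shift_uniform_dens divide_right_mono)
  have scaled_tail: "deviation (shift (real N) (rho_scale \<mu> \<theta>)) \<omega> \<le> \<epsilon>" for \<omega>
    using N \<theta> by (intro deviation_shift_rho_scale_le scale) auto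
  have "interval_deviation T \<omega> / T = deviation (uniform_dens T) \<omega>"
    using T(1) by (simp add: deviation_uniform_dens)
  also have "\<dots> \<le> deviation (rho_scale \<mu> \<theta>) \<omega> + D / T + \<epsilon>
      + 2 * (LINT t:{0..<real N}|lebesgue. \<bar>uniform_dens T t - rho_scale \<mu> \<theta> t\<bar>)"
    using uniform scaled by (intro deviation_comparison N uniform_tail scaled_tail) auto
  also have "\<dots> \<le> \<epsilon> + D / T + \<epsilon> + 2 * (C * (real N / (\<mu> 0 * T))\<^sup>2)"
    using scale[OF \<theta>, of \<omega>] integral_uniform_dens_diff_rho_scale_le[OF T(1) _ T(2)] by (simp add: \<theta>_def)
  finally have "interval_deviation T \<omega> \<le> (\<epsilon> + D / T + \<epsilon> + 2 * (C * (real N / (\<mu> 0 * T))\<^sup>2)) * T"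
    using T(1) by (simp add: pos_divide_le_eq)
  also have "real N / (\<mu> 0 * T) = 1 / (\<mu> 0 * real (Suc k))" using N by (simp add: T_def)
  also have "(\<epsilon> + D / T + \<epsilon> + 2 * (C * (1 / (\<mu> 0 * real (Suc k)))\<^sup>2)) * T
      = D + real N * (2 * \<epsilon> * real (Suc k) + 2 * C / (\<mu> 0)\<^sup>2 / real (Suc k))"
    using N initial_pos by (simp add: T_def power2_eq_square field_simps del: of_nat_Suc)
  finally show ?thesis by (simp add: T_def)
qed

lemma interval_deviation_le_harm:
  fixes k N :: nat
  assumes N: "1 \<le> N" and small: "1 / (\<mu> 0 * real N) < \<theta>0"
    and scale: "\<And>\<theta> \<omega>. 0 < \<theta> \<Longrightarrow> \<theta> < \<theta>0 \<Longrightarrow> deviation (rho_scale \<mu> \<theta>) \<omega> \<le> \<epsilon>"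
  shows "interval_deviation (real k * real N) \<omega>
    \<le> real N * (\<epsilon> * (real k * (real k + 1)) + 2 * C / (\<mu> 0)\<^sup>2 * harm k)"
proof (induction k arbitrary: \<omega>)
  case 0
  show ?case using interval_deviation_le[of 0 \<omega>] by (simp add: harm_expand)
next
  case (Suc k)
  have "1 / (\<mu> 0 * (real (Suc k) * real N)) \<le> 1 / (\<mu> 0 * real N)"
    using N initial_pos by (intro divide_left_mono mult_left_mono) auto
  then have "1 / (\<mu> 0 * (real (Suc k) * real N)) < \<theta>0" using small by linarith
  from interval_deviation_step[OF N this scale Suc.IH]
  have "interval_deviation (real (Suc k) * real N) \<omega>
    \<le> real N * (\<epsilon> * (real k * (real k + 1)) + 2 * C / (\<mu> 0)\<^sup>2 * harm k)
      + real N * (2 * \<epsilon> * real (Suc k) + 2 * C / (\<mu> 0)\<^sup>2 / real (Suc k))" .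
  also have "\<dots> = real N * (\<epsilon> * (real (Suc k) * (real (Suc k) + 1))
      + 2 * C / (\<mu> 0)\<^sup>2 * (harm k + inverse (real (Suc k))))"
    by (simp add: divide_inverse algebra_simps)
  also have "harm k + inverse (real (Suc k)) = harm (Suc k)" by (simp add: harm_Suc)
  finally show ?case .
qed

end

definition scale_limit :: "(real \<Rightarrow> real) \<Rightarrow> bool" where
  "scale_limit \<mu> \<longleftrightarrow> (\<forall>\<epsilon>>0. \<forall>\<^sub>F \<theta> in at_right 0. \<forall>\<omega>. deviation (rho_scale \<mu> \<theta>) \<omega> \<le> \<epsilon>)"

lemma cesaro_limit_if_selfsimilar:
  assumes \<mu>: "selfsimilar_density \<mu> C" and limit: "scale_limit \<mu>"
  shows cesaro_limit
proof (rule cesaro_limit_if_multiples)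
  interpret selfsimilar_density \<mu> C by (rule \<mu>)
  fix \<epsilon> :: real assume \<epsilon>: "0 < \<epsilon>"
  define K where "K = 2 * C / (\<mu> 0)\<^sup>2"
  obtain n where n: "1 \<le> n" and harm: "K * harm n \<le> \<epsilon> / 2 * real n"
    using harm_sublinear[OF half_gt_zero[OF \<epsilon>]] by blast
  define \<eta> where "\<eta> = \<epsilon> / (2 * (real n + 1))"
  have \<eta>: "0 < \<eta>" using \<epsilon> by (simp add: \<eta>_def)
  then obtain \<theta>0 where \<theta>0: "0 < \<theta>0"
    and scale: "\<And>\<theta> \<omega>. 0 < \<theta> \<Longrightarrow> \<theta> < \<theta>0 \<Longrightarrow> deviation (rho_scale \<mu> \<theta>) \<omega> \<le> \<eta>"
    using limit by (auto simp: scale_limit_def eventually_at_right_field)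
  define N0 where "N0 = nat \<lfloor>1 / (\<mu> 0 * \<theta>0)\<rfloor> + 1"
  have "interval_deviation (real n * real N) \<omega> \<le> \<epsilon> * (real n * real N)" if "N0 \<le> N" for N \<omega>
  proof -
    have N: "1 \<le> N" "1 / (\<mu> 0 * \<theta>0) < real N"
      using that unfolding N0_def by linarith+
    then have "1 / (\<mu> 0 * real N) < \<theta>0"
      using \<theta>0 initial_pos by (simp add: field_simps)
    from interval_deviation_le_harm[OF \<mu> N(1) this scale]
    have "interval_deviation (real n * real N) \<omega> \<le> real N * (\<eta> * (real n * (real n + 1)) + K * harm n)"
      by (simp add: K_def)
    also have "\<eta> * (real n * (real n + 1)) = \<epsilon> / 2 * real n"
      by (simp add: \<eta>_def field_simps)
    also have "real N * (\<epsilon> / 2 * real n + K * harm n) \<le> real N * (\<epsilon> / 2 * real n + \<epsilon> / 2 * real n)"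
      using harm by (intro mult_left_mono add_left_mono) auto
    finally show ?thesis by (simp add: algebra_simps)
  qed
  with n show "\<exists>n\<ge>1. \<exists>N0. \<forall>N\<ge>N0. \<forall>\<omega>. interval_deviation (real n * real N) \<omega> \<le> \<epsilon> * (real n * real N)"
    by blast
qed

subsection \<open>From uniform means to scaled densities\<close>

lemma deviation_const_interval_le:
  assumes "interval_deviation_bound \<eta> T0" "0 \<le> a" "0 \<le> T"
  shows "deviation (\<lambda>t. a * indicat_real {0..T} t) \<omega> \<le> \<eta> * (a * T) + a * T0"
proof -
  have "deviation (\<lambda>t. a * indicat_real {0..T} t) \<omega> = a * interval_deviation T \<omega>"
    using assms by (intro deviation_cmult weight_indicator) auto
  also have "\<dots> \<le> a * (\<eta> * T + T0)"
    using assms by (intro mult_left_mono) (auto simp: interval_deviation_bound_def)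
  finally show ?thesis by (simp add: algebra_simps)
qed

lemma deviation_prepend_const:
  assumes mean: "interval_deviation_bound \<eta> T0"
    and f: "weight f" and N: "1 \<le> N" and a: "0 < a"
    and initially_const: "\<And>t. 0 \<le> t \<Longrightarrow> t < real N \<Longrightarrow> f t = a"
    and tail_f: "\<And>\<omega>. deviation (shift (real N) f) \<omega> \<le> D"
  shows "deviation f \<omega> \<le> D + 2 * \<eta> * mass f + 2 * a * T0"
proof -
  define R where "R = mass (shift (real N) f) / a"
  define h where "h t = a * indicat_real {0..real N + R} t" for t
  have R: "0 \<le> R" using mass_nonneg[OF weight_shift[OF f]] a by (simp add: R_def)
  have h: "weight h"
    unfolding h_def using a by (intro weight_cmult weight_indicator) auto
  have mass_f: "mass f = a * (real N + R)"
    using mass_initially_const[OF f _ initially_const] a by (simp add: R_def distrib_left)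
  then have mass: "mass f = mass h"
    using R by (simp add: h_def mass_indicator_Icc)
  have "deviation (shift (real N) h) \<omega> = deviation (\<lambda>t. a * indicat_real {0..R} t) \<omega>" for \<omega>
    by (rule deviation_cong[OF weight_shift[OF h]]) (auto simp: shift_def h_def indicator_def)
  also have "deviation (\<lambda>t. a * indicat_real {0..R} t) \<omega> \<le> \<eta> * (a * R) + a * T0" for \<omega>
    using a R by (intro deviation_const_interval_le[OF mean]) auto
  finally have tail_h: "deviation (shift (real N) h) \<omega> \<le> \<eta> * (a * R) + a * T0" for \<omega> .
  have head: "(LINT t:{0..<real N}|lebesgue. \<bar>f t - h t\<bar>) = (LINT t:{0..<real N}|lebesgue. 0)"
    using R initially_const by (intro set_lebesgue_integral_cong) (auto simp: h_def)
  have "deviation f \<omega> \<le> deviation h \<omega> + D + (\<eta> * (a * R) + a * T0)"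
    using deviation_comparison[OF f h mass N tail_f tail_h, of \<omega>] by (simp add: head)
  also have "deviation h \<omega> \<le> \<eta> * mass f + a * T0"
    unfolding h_def mass_f using a R by (intro deviation_const_interval_le[OF mean]) auto
  also have "\<eta> * (a * R) \<le> \<eta> * mass f"
    unfolding mass_f using mean a by (intro mult_left_mono) (auto simp: interval_deviation_bound_def)
  finally show ?thesis by (simp add: algebra_simps)
qed

lemma deviation_step_fun_le:
  assumes mean: "interval_deviation_bound \<eta> T0" and N: "1 \<le> N"
  shows "step_heights a n \<Longrightarrow>
    deviation (step_fun a (real N)) \<omega> \<le> (2 * \<eta> * real n + 2 * T0 / real N) * mass (step_fun a (real N))"
proof (induction n arbitrary: a \<omega>)
  case 0
  then have "step_fun a (real N) = (\<lambda>t. 0)" by (simp add: step_fun_def step_heights_def fun_eq_iff)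
  then show ?case using deviation_le_mass[of "\<lambda>t. 0"] by (simp add: weight_def set_integrable_def)
next
  case (Suc n)
  define f where "f = step_fun a (real N)"
  define rest where "rest = step_fun (\<lambda>i. a (Suc i)) (real N)"
  have N_pos: "0 < real N" using N by simp
  have heights: "step_heights (\<lambda>i. a (Suc i)) n" and a0: "0 < a 0"
    using Suc.prems by (auto simp: step_heights_def)
  have f: "weight f" unfolding f_def by (rule weight_step_fun[OF N_pos Suc.prems])
  have shift: "shift (real N) f t = rest t" if "0 \<le> t" for t
    unfolding f_def rest_def by (rule shift_step_fun[OF N_pos that])
  have initial: "f t = a 0" if "0 \<le> t" "t < real N" for t
    unfolding f_def using that N_pos by (intro step_fun_eq) auto
  have mass_f: "mass f = a 0 * real N + mass rest"
    using mass_initially_const[OF f of_nat_0_le_iff initial] mass_cong[of "shift (real N) f" rest] shift by simp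
  define c where "c = 2 * T0 / real N"
  have "deviation (shift (real N) f) \<omega> = deviation rest \<omega>" for \<omega>
    by (intro deviation_cong weight_shift[OF f] shift) auto
  also have "deviation rest \<omega> \<le> (2 * \<eta> * real n + c) * mass rest" for \<omega>
    unfolding rest_def c_def by (rule Suc.IH[OF heights])
  finally have tail: "deviation (shift (real N) f) \<omega> \<le> (2 * \<eta> * real n + c) * mass rest" for \<omega> .
  have "deviation f \<omega> \<le> (2 * \<eta> * real n + c) * mass rest + 2 * \<eta> * mass f + 2 * a 0 * T0"
    by (rule deviation_prepend_const[OF mean f N a0 initial tail])
  also have "2 * a 0 * T0 = c * (a 0 * real N)" using N_pos by (simp add: c_def)
  also have "(2 * \<eta> * real n + c) * mass rest \<le> 2 * \<eta> * real n * mass f + c * mass rest"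
    using mean a0 by (simp add: interval_deviation_bound_def distrib_right mass_f mult_left_mono)
  also have "2 * \<eta> * real n * mass f + c * mass rest + 2 * \<eta> * mass f + c * (a 0 * real N)
      = (2 * \<eta> * real (Suc n) + c) * mass f"
    by (simp add: mass_f algebra_simps)
  finally show ?case unfolding f_def c_def by simp
qed

lemma deviation_rho_scale_step_fun_le:
  assumes mean: "interval_deviation_bound \<eta> T0"
    and N: "1 \<le> N" and \<theta>: "0 < \<theta>" and a: "step_heights a n"
  shows "deviation (rho_scale (step_fun a (\<theta> * real N)) \<theta>) \<omega>
    \<le> (2 * \<eta> * real n + 2 * T0 / real N) * mass (step_fun a (\<theta> * real N))"
proof -
  have "step_heights (\<lambda>i. \<theta> * a i) n" using a \<theta> by (simp add: step_heights_def)
  from deviation_step_fun_le[OF mean N this]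
  have "deviation (rho_scale (step_fun a (\<theta> * real N)) \<theta>) \<omega>
    \<le> (2 * \<eta> * real n + 2 * T0 / real N) * mass (rho_scale (step_fun a (\<theta> * real N)) \<theta>)"
    by (simp add: rho_scale_step_fun[OF \<theta>])
  then show ?thesis by (simp add: mass_rho_scale[OF \<theta>])
qed

lemma deviation_rho_scale_le:
  assumes mean: "interval_deviation_bound \<eta> T0"
    and \<mu>: "weight \<mu>" and steps: "step_approximable \<mu> \<epsilon> b h"
    and \<theta>: "0 < \<theta>" "2 * \<theta> \<le> h"
  shows "deviation (rho_scale \<mu> \<theta>) \<omega> \<le> (4 * \<eta> * b / h + 4 * T0 * \<theta> / h) * (mass \<mu> + \<epsilon>) + 2 * \<epsilon>"
proof -
  have \<eta>: "0 \<le> \<eta>" and T0: "0 \<le> T0"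
    using mean by (auto simp: interval_deviation_bound_def)
  define N where "N = nat \<lfloor>h / \<theta>\<rfloor>"
  have "2 \<le> h / \<theta>" using \<theta> by (simp add: field_simps)
  then have N: "1 \<le> N" "real N \<le> h / \<theta>" "h / \<theta> \<le> 2 * real N" unfolding N_def by linarith+
  then have \<delta>: "0 < \<theta> * real N" "\<theta> * real N \<le> h" "h \<le> 2 * (\<theta> * real N)"
    using \<theta> by (auto simp: field_simps)
  obtain a n where heights: "step_heights a n" and length: "real n * (\<theta> * real N) \<le> b"
    and close: "L1_dist \<mu> (step_fun a (\<theta> * real N)) \<le> \<epsilon>"
    using steps \<delta>(1,2) unfolding step_approximable_def by blast
  define F where "F = step_fun a (\<theta> * real N)"
  have F: "weight F" unfolding F_def by (rule weight_step_fun[OF \<delta>(1) heights])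
  have mass_F: "mass F \<le> mass \<mu> + \<epsilon>"
    using abs_mass_diff_le_L1_dist[OF \<mu> F] close by (simp add: F_def)
  have "real n * h \<le> 2 * b" using mult_left_mono[OF \<delta>(3), of "real n"] length by simp
  then have "2 * \<eta> * (real n * h) \<le> 2 * \<eta> * (2 * b)" using \<eta> by (intro mult_left_mono) auto
  then have "2 * \<eta> * real n \<le> 4 * \<eta> * b / h" using \<theta> by (simp add: field_simps)
  moreover have "2 * T0 * h \<le> 2 * T0 * (2 * (\<theta> * real N))" using \<delta>(3) T0 by (intro mult_left_mono) auto
  then have "2 * T0 / real N \<le> 4 * T0 * \<theta> / h" using N \<theta> by (simp add: field_simps)
  ultimately have "2 * \<eta> * real n + 2 * T0 / real N \<le> 4 * \<eta> * b / h + 4 * T0 * \<theta> / h" by (rule add_mono)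
  moreover have "0 \<le> 2 * \<eta> * real n + 2 * T0 / real N" using \<eta> T0 by simp
  ultimately have "(2 * \<eta> * real n + 2 * T0 / real N) * mass F
      \<le> (4 * \<eta> * b / h + 4 * T0 * \<theta> / h) * (mass \<mu> + \<epsilon>)"
    using mass_F mass_nonneg[OF F] by (intro mult_mono) auto
  moreover have "deviation (rho_scale F \<theta>) \<omega> \<le> (2 * \<eta> * real n + 2 * T0 / real N) * mass F"
    unfolding F_def by (rule deviation_rho_scale_step_fun_le[OF mean N(1) \<theta>(1) heights])
  moreover have "deviation (rho_scale \<mu> \<theta>) \<omega> \<le> deviation (rho_scale F \<theta>) \<omega> + 2 * \<epsilon>"
    using deviation_le_L1_dist[OF weight_rho_scale[OF \<mu>] weight_rho_scale[OF F], of \<theta> \<theta> \<omega>]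
      close \<theta>(1) by (simp add: L1_dist_rho_scale F_def)
  ultimately show ?thesis by linarith
qed

lemma scale_limit_if_cesaro:
  assumes cesaro: cesaro_limit and \<mu>: "\<mu> \<in> density_set"
  shows "scale_limit \<mu>"
  unfolding scale_limit_def
proof (intro allI impI)
  fix \<epsilon> :: real assume \<epsilon>: "0 < \<epsilon>"
  have \<mu>_weight: "weight \<mu>" "mass \<mu> = 1" using \<mu> by (auto simp: density_set_iff_weight)
  define e where "e = min 1 (\<epsilon> / 4)"
  have e: "0 < e" "e \<le> 1" "4 * e \<le> \<epsilon>" using \<epsilon> by (auto simp: e_def)
  obtain b h where b: "0 < b" and h: "0 < h" and steps: "step_approximable \<mu> e b h"
    by (rule weight_step_approximation[OF \<mu>_weight(1) e(1)])
  define \<eta> where "\<eta> = e * h / (8 * b)"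
  have \<eta>: "0 < \<eta>" using e b h by (simp add: \<eta>_def)
  obtain T0 where mean: "interval_deviation_bound \<eta> T0"
    by (rule interval_deviation_bound_if_cesaro[OF cesaro \<eta>])
  then have T0: "0 \<le> T0" by (simp add: interval_deviation_bound_def)
  have "\<forall>\<^sub>F \<theta> in at_right 0. 2 * \<theta> \<le> h" and "\<forall>\<^sub>F \<theta> in at_right 0. 4 * T0 * \<theta> / h \<le> e / 2"
    using h e T0 by real_asymp+
  with eventually_at_right_less[of 0]
  show "\<forall>\<^sub>F \<theta> in at_right 0. \<forall>\<omega>. deviation (rho_scale \<mu> \<theta>) \<omega> \<le> \<epsilon>"
  proof eventually_elim
    case (elim \<theta>)
    have "4 * \<eta> * b / h = e / 2" using b h by (simp add: \<eta>_def)
    then have "(4 * \<eta> * b / h + 4 * T0 * \<theta> / h) * (mass \<mu> + e) \<le> e * 2"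
      using elim(3) e h T0 elim(1) by (intro mult_mono) (auto simp: \<mu>_weight(2))
    then have "deviation (rho_scale \<mu> \<theta>) \<omega> \<le> \<epsilon>" for \<omega>
      using deviation_rho_scale_le[OF mean \<mu>_weight(1) steps elim(1,2), of \<omega>] e(3)
      by simp
    then show ?case ..
  qed
qed

subsection \<open>Equivalence of the limits\<close>

abbreviation sup_deviation :: "(real \<Rightarrow> real) \<Rightarrow> real" where
  "sup_deviation f \<equiv> (SUP \<omega>. \<bar>V f \<omega> - U \<omega>\<bar>)"

lemma sup_deviation_le_iff:
  assumes "f \<in> density_set"
  shows "sup_deviation f \<le> \<epsilon> \<longleftrightarrow> (\<forall>\<omega>. deviation f \<omega> \<le> \<epsilon>)"
proof -
  have "bdd_above (range (deviation f))"
    using deviation_le_mass[of f] assms by (intro bdd_aboveI2[of _ _ 1]) (auto simp: density_set_iff_weight)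
  then have "(SUP \<omega>. deviation f \<omega>) \<le> \<epsilon> \<longleftrightarrow> (\<forall>\<omega>. deviation f \<omega> \<le> \<epsilon>)"
    by (simp add: cSUP_le_iff)
  then show ?thesis using assms by (simp add: deviation_def density_set_iff_weight)
qed

lemma sup_deviation_nonneg: "f \<in> density_set \<Longrightarrow> 0 \<le> sup_deviation f"
  using sup_deviation_le_iff[of f "sup_deviation f"] order_trans[of 0 "deviation f undefined"]
  by (simp add: deviation_def)

lemma sup_deviation_tendsto_iff:
  assumes density: "\<forall>\<^sub>F x in F. R x \<in> density_set"
  shows "((\<lambda>x. sup_deviation (R x)) \<longlongrightarrow> 0) F
    \<longleftrightarrow> (\<forall>\<epsilon>>0. \<forall>\<^sub>F x in F. \<forall>\<omega>. deviation (R x) \<omega> \<le> \<epsilon>)"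
proof (intro iffI allI impI)
  fix \<epsilon> :: real assume "((\<lambda>x. sup_deviation (R x)) \<longlongrightarrow> 0) F" "0 < \<epsilon>"
  then have "\<forall>\<^sub>F x in F. sup_deviation (R x) < \<epsilon>" by (rule order_tendstoD)
  with density show "\<forall>\<^sub>F x in F. \<forall>\<omega>. deviation (R x) \<omega> \<le> \<epsilon>"
    by eventually_elim (simp flip: sup_deviation_le_iff)
next
  assume small: "\<forall>\<epsilon>>0. \<forall>\<^sub>F x in F. \<forall>\<omega>. deviation (R x) \<omega> \<le> \<epsilon>"
  show "((\<lambda>x. sup_deviation (R x)) \<longlongrightarrow> 0) F"
  proof (rule tendstoI)
    fix \<epsilon> :: real assume \<epsilon>: "0 < \<epsilon>"
    then have "\<forall>\<^sub>F x in F. \<forall>\<omega>. deviation (R x) \<omega> \<le> \<epsilon> / 2"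
      using small half_gt_zero by blast
    with density show "\<forall>\<^sub>F x in F. dist (sup_deviation (R x)) 0 < \<epsilon>"
    proof eventually_elim
      case (elim x)
      have "sup_deviation (R x) \<le> \<epsilon> / 2" using sup_deviation_le_iff[OF elim(1)] elim(2) by blast
      then show ?case using sup_deviation_nonneg[OF elim(1)] \<epsilon> by (simp add: dist_real_def)
    qed
  qed
qed

lemma rho_scale_limit_iff:
  assumes "\<mu> \<in> density_set"
  shows "((\<lambda>\<theta>. sup_deviation (rho_scale \<mu> \<theta>)) \<longlongrightarrow> 0) (at_right 0) \<longleftrightarrow> scale_limit \<mu>"
proof -
  have "\<forall>\<^sub>F \<theta> in at_right 0. rho_scale \<mu> \<theta> \<in> density_set"
    using eventually_at_right_less[of 0] by eventually_elim (rule rho_scale_in_density_set[OF assms])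
  then show ?thesis unfolding scale_limit_def by (rule sup_deviation_tendsto_iff)
qed

lemma rho_scale_limit_iff_cesaro:
  assumes "selfsimilar_density \<mu> C"
  shows "((\<lambda>\<theta>. sup_deviation (rho_scale \<mu> \<theta>)) \<longlongrightarrow> 0) (at_right 0) \<longleftrightarrow> cesaro_limit"
  using selfsimilar_density.density[OF assms] cesaro_limit_if_selfsimilar[OF assms]
    scale_limit_if_cesaro by (auto simp: rho_scale_limit_iff)

lemma exp_dens_limit_iff_cesaro:
  "((\<lambda>\<theta>. sup_deviation (exp_dens \<theta>)) \<longlongrightarrow> 0) (at_right 0) \<longleftrightarrow> cesaro_limit"
  using rho_scale_limit_iff_cesaro[OF exp_dens_selfsimilar] by (simp add: rho_scale_exp_dens)

lemma uniform_dens_limit_iff_cesaro: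
  "((\<lambda>T. sup_deviation (uniform_dens T)) \<longlongrightarrow> 0) at_top \<longleftrightarrow> cesaro_limit"
proof -
  have "\<forall>\<^sub>F T in at_top. uniform_dens T \<in> density_set"
    using eventually_gt_at_top[of 0] by eventually_elim (rule uniform_dens_in_density_set)
  then have "((\<lambda>T. sup_deviation (uniform_dens T)) \<longlongrightarrow> 0) at_top
      \<longleftrightarrow> (\<forall>\<epsilon>>0. \<forall>\<^sub>F T in at_top. \<forall>\<omega>. deviation (uniform_dens T) \<omega> \<le> \<epsilon>)"
    by (rule sup_deviation_tendsto_iff)
  also have "\<dots> \<longleftrightarrow> cesaro_limit"
    unfolding cesaro_limit_def
    by (intro all_cong eventually_subst eventually_mono[OF eventually_gt_at_top[of 0]])
      (simp add: deviation_uniform_dens pos_divide_le_eq)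
  finally show ?thesis .
qed

lemma power_density_shift_limit_iff_cesaro:
  assumes \<rho>: "power_density \<rho>"
  shows "((\<lambda>T. sup_deviation (rho_shift \<rho> T)) \<longlongrightarrow> 0) at_top \<longleftrightarrow> cesaro_limit"
proof -
  have density: "\<rho> \<in> density_set" using \<rho> by (simp add: power_density_def)
  obtain \<alpha> \<beta> where pos: "0 < \<alpha>" "0 < \<beta>"
    and shift_eq_scale: "\<And>T t. 0 \<le> T \<Longrightarrow> 0 \<le> t \<Longrightarrow> rho_shift \<rho> T t = rho_scale \<rho> (\<alpha> / (\<alpha> + \<beta> * T)) t"
    by (rule power_density_shift_eq_scale[OF \<rho>]) (rule that)
  obtain C where C: "selfsimilar_density \<rho> C"
    by (rule power_density_selfsimilar[OF \<rho>])
  have V_rho_shift: "V (rho_shift \<rho> T) = V (rho_scale \<rho> (\<alpha> / (\<alpha> + \<beta> * T)))" if T: "0 \<le> T" for T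
  proof
    have "0 < \<alpha> / (\<alpha> + \<beta> * T)" using pos T by (simp add: add_pos_nonneg)
    then have "weight (rho_scale \<rho> (\<alpha> / (\<alpha> + \<beta> * T)))"
      using density by (simp add: density_set_iff_weight weight_rho_scale)
    then show "V (rho_shift \<rho> T) \<omega> = V (rho_scale \<rho> (\<alpha> / (\<alpha> + \<beta> * T))) \<omega>" for \<omega>
      by (rule V_cong[symmetric]) (rule shift_eq_scale[OF T, symmetric])
  qed
  have reparametrise: "filtermap (\<lambda>T. \<alpha> / (\<alpha> + \<beta> * T)) at_top = at_right 0"
  proof (rule filtermap_fun_inverse[where g = "\<lambda>\<theta>. (\<alpha> / \<theta> - \<alpha>) / \<beta>"])
    show "filterlim (\<lambda>\<theta>. (\<alpha> / \<theta> - \<alpha>) / \<beta>) at_top (at_right 0)"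
      and "filterlim (\<lambda>T. \<alpha> / (\<alpha> + \<beta> * T)) (at_right 0) at_top"
      using pos by real_asymp+
    show "\<forall>\<^sub>F \<theta> in at_right 0. \<alpha> / (\<alpha> + \<beta> * ((\<alpha> / \<theta> - \<alpha>) / \<beta>)) = \<theta>"
      using eventually_at_right_less[of 0] by eventually_elim (use pos in \<open>simp add: field_simps\<close>)
  qed
  have "((\<lambda>T. sup_deviation (rho_shift \<rho> T)) \<longlongrightarrow> 0) at_top
      \<longleftrightarrow> ((\<lambda>T. sup_deviation (rho_scale \<rho> (\<alpha> / (\<alpha> + \<beta> * T)))) \<longlongrightarrow> 0) at_top"
    by (intro filterlim_cong refl eventually_mono[OF eventually_ge_at_top[of 0]]) (simp add: V_rho_shift)
  also have "\<dots> \<longleftrightarrow> ((\<lambda>\<theta>. sup_deviation (rho_scale \<rho> \<theta>)) \<longlongrightarrow> 0) (at_right 0)"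
    unfolding reparametrise[symmetric] filterlim_filtermap ..
  also have "\<dots> \<longleftrightarrow> cesaro_limit" by (rule rho_scale_limit_iff_cesaro[OF C])
  finally show ?thesis .
qed

lemma piecewise_cont_scale_limit_iff_cesaro:
  "(\<forall>\<mu>\<in>density_set. piecewise_cont_pos \<mu>
      \<longrightarrow> ((\<lambda>\<theta>. sup_deviation (rho_scale \<mu> \<theta>)) \<longlongrightarrow> 0) (at_right 0)) \<longleftrightarrow> cesaro_limit"
  using scale_limit_if_cesaro exp_dens_in_density_set exp_dens_piecewise_cont_pos
    rho_scale_limit_iff_cesaro[OF exp_dens_selfsimilar] by (auto simp: rho_scale_limit_iff)

lemma some_power_density_limit_iff_cesaro:
  "(\<exists>\<rho>. power_density \<rho> \<and> ((\<lambda>T. sup_deviation (rho_shift \<rho> T)) \<longlongrightarrow> 0) at_top) \<longleftrightarrow> cesaro_limit"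
  using power_density_exists power_density_shift_limit_iff_cesaro by blast

lemma every_power_density_limit_iff_cesaro:
  "(\<forall>\<rho>. power_density \<rho> \<longrightarrow> ((\<lambda>T. sup_deviation (rho_shift \<rho> T)) \<longlongrightarrow> 0) at_top) \<longleftrightarrow> cesaro_limit"
  using power_density_exists power_density_shift_limit_iff_cesaro by blast

end

section \<open>Sup-inf expectations\<close>

definition sup_inf_expectation ::
    "'l set \<Rightarrow> 'm set \<Rightarrow> ('l \<Rightarrow> 'm \<Rightarrow> 'a measure) \<Rightarrow> ('a \<Rightarrow> real) \<Rightarrow> real" where
  "sup_inf_expectation A B P F = (SUP l\<in>A. INF m\<in>B. integral\<^sup>L (P l m) F)"

definition bounded_measurable :: "'a measure \<Rightarrow> ('a \<Rightarrow> real) \<Rightarrow> bool" where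
  "bounded_measurable K F \<longleftrightarrow> F \<in> borel_measurable K \<and> bounded (F ` space K)"

lemma bounded_measurable_const: "bounded_measurable K (\<lambda>z. c)"
  unfolding bounded_measurable_def by (auto intro: finite_imp_bounded finite_subset[of _ "{c}"])

lemma bounded_measurable_add:
  "bounded_measurable K F \<Longrightarrow> bounded_measurable K G \<Longrightarrow> bounded_measurable K (\<lambda>z. F z + G z)"
  unfolding bounded_measurable_def using bounded_plus_comp[of F "space K" G] by auto

locale prob_space_family =
  fixes K :: "'a measure" and A :: "'l set" and B :: "'m set" and P :: "'l \<Rightarrow> 'm \<Rightarrow> 'a measure"
  assumes A_ne: "A \<noteq> {}" and B_ne: "B \<noteq> {}"
    and prob_P: "l \<in> A \<Longrightarrow> m \<in> B \<Longrightarrow> prob_space (P l m)"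
    and sets_P: "l \<in> A \<Longrightarrow> m \<in> B \<Longrightarrow> sets (P l m) = sets K"
begin

lemma space_P: "l \<in> A \<Longrightarrow> m \<in> B \<Longrightarrow> space (P l m) = space K"
  by (rule sets_eq_imp_space_eq[OF sets_P])

lemma integrable_P:
  assumes "bounded_measurable K F" "l \<in> A" "m \<in> B" shows "integrable (P l m) F"
proof -
  interpret prob_space "P l m" using prob_P assms by auto
  obtain c where "\<And>z. z \<in> space K \<Longrightarrow> \<bar>F z\<bar> \<le> c"
    using assms by (auto simp: bounded_measurable_def bounded_real)
  moreover have "F \<in> borel_measurable (P l m)"
    using assms sets_P[OF assms(2,3)] by (simp add: bounded_measurable_def cong: measurable_cong_sets)
  ultimately show ?thesis
    using space_P[OF assms(2,3)] by (intro integrable_const_bound[of _ c]) auto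
qed

lemma expectation_const: "l \<in> A \<Longrightarrow> m \<in> B \<Longrightarrow> (\<integral>z. c \<partial>P l m) = (c::real)"
  by (simp add: prob_space.prob_space[OF prob_P])

lemma expectation_le_add_const:
  assumes F: "bounded_measurable K F" and G: "bounded_measurable K G"
    and pointwise: "\<And>z. z \<in> space K \<Longrightarrow> F z \<le> G z + d" and strategies: "l \<in> A" "m \<in> B"
  shows "integral\<^sup>L (P l m) F \<le> integral\<^sup>L (P l m) G + d"
proof -
  interpret prob_space "P l m" using prob_P strategies by auto
  have "integral\<^sup>L (P l m) F \<le> (\<integral>z. G z + d \<partial>P l m)"
    using pointwise space_P[OF strategies] integrable_P[OF F strategies] integrable_P[OF G strategies]
    by (intro integral_mono) auto
  also have "\<dots> = integral\<^sup>L (P l m) G + d"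
    using integrable_P[OF G strategies] by (simp add: prob_space)
  finally show ?thesis .
qed

lemma abs_expectation_bounded:
  assumes F: "bounded_measurable K F"
  obtains c where "\<And>l m. l \<in> A \<Longrightarrow> m \<in> B \<Longrightarrow> \<bar>integral\<^sup>L (P l m) F\<bar> \<le> c"
proof -
  obtain c where bound: "\<And>z. z \<in> space K \<Longrightarrow> \<bar>F z\<bar> \<le> c"
    using F by (auto simp: bounded_measurable_def bounded_real)
  have "\<bar>integral\<^sup>L (P l m) F\<bar> \<le> c" if strategies: "l \<in> A" "m \<in> B" for l m
  proof -
    have "F z \<le> 0 + c" "0 \<le> F z + c" if "z \<in> space K" for z
      using bound[OF that] by linarith+
    then show ?thesis
      using expectation_le_add_const[OF F bounded_measurable_const[of K 0] _ strategies, of c]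
        expectation_le_add_const[OF bounded_measurable_const[of K 0] F _ strategies, of c]
      by (simp add: expectation_const[OF strategies])
  qed
  then show ?thesis by (rule that)
qed

lemma bdd_below_expectation:
  assumes "bounded_measurable K F" "l \<in> A"
  shows "bdd_below ((\<lambda>m. integral\<^sup>L (P l m) F) ` B)"
proof -
  obtain c where "\<And>m. m \<in> B \<Longrightarrow> \<bar>integral\<^sup>L (P l m) F\<bar> \<le> c"
    using abs_expectation_bounded[OF assms(1)] assms(2) by metis
  then show ?thesis
    by (intro bdd_belowI2[of _ "- c"]) (simp add: abs_le_iff minus_le_iff)
qed

lemma bdd_above_INF_expectation:
  assumes F: "bounded_measurable K F"
  shows "bdd_above ((\<lambda>l. INF m\<in>B. integral\<^sup>L (P l m) F) ` A)"
proof -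
  obtain c where bound: "\<And>l m. l \<in> A \<Longrightarrow> m \<in> B \<Longrightarrow> \<bar>integral\<^sup>L (P l m) F\<bar> \<le> c"
    using abs_expectation_bounded[OF F] by metis
  obtain m where m: "m \<in> B" using B_ne by blast
  show ?thesis
  proof (rule bdd_aboveI2)
    fix l assume l: "l \<in> A"
    have "(INF m\<in>B. integral\<^sup>L (P l m) F) \<le> integral\<^sup>L (P l m) F"
      by (intro cINF_lower bdd_below_expectation F l m)
    also have "\<dots> \<le> c" using bound[OF l m] by simp
    finally show "(INF m\<in>B. integral\<^sup>L (P l m) F) \<le> c" .
  qed
qed

lemma sup_inf_expectation_le_add_const:
  assumes F: "bounded_measurable K F" and G: "bounded_measurable K G"
    and pointwise: "\<And>z. z \<in> space K \<Longrightarrow> F z \<le> G z + d"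
  shows "sup_inf_expectation A B P F \<le> sup_inf_expectation A B P G + d"
  unfolding sup_inf_expectation_def
proof (rule cSUP_least[OF A_ne])
  fix l assume l: "l \<in> A"
  have "(INF m\<in>B. integral\<^sup>L (P l m) F) - d \<le> (INF m\<in>B. integral\<^sup>L (P l m) G)"
  proof (rule cINF_greatest[OF B_ne])
    fix m assume m: "m \<in> B"
    have "(INF m\<in>B. integral\<^sup>L (P l m) F) \<le> integral\<^sup>L (P l m) F"
      by (intro cINF_lower bdd_below_expectation F l m)
    with expectation_le_add_const[OF F G pointwise l m]
    show "(INF m\<in>B. integral\<^sup>L (P l m) F) - d \<le> integral\<^sup>L (P l m) G" by auto
  qed
  also have "\<dots> \<le> (SUP l\<in>A. INF m\<in>B. integral\<^sup>L (P l m) G)"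
    by (intro cSUP_upper bdd_above_INF_expectation G l)
  finally show "(INF m\<in>B. integral\<^sup>L (P l m) F) \<le> (SUP l\<in>A. INF m\<in>B. integral\<^sup>L (P l m) G) + d"
    by simp
qed

lemma sup_inf_expectation_diff_le:
  assumes F: "bounded_measurable K F" and G: "bounded_measurable K G"
    and pointwise: "\<And>z. z \<in> space K \<Longrightarrow> \<bar>F z - G z\<bar> \<le> d"
  shows "\<bar>sup_inf_expectation A B P F - sup_inf_expectation A B P G\<bar> \<le> d"
proof -
  have "F z \<le> G z + d" "G z \<le> F z + d" if "z \<in> space K" for z
    using pointwise[OF that] by linarith+
  then show ?thesis
    using sup_inf_expectation_le_add_const[OF F G, of d] sup_inf_expectation_le_add_const[OF G F, of d]
    by fastforce
qed

lemma sup_inf_expectation_const: "sup_inf_expectation A B P (\<lambda>z. c) = c"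
proof -
  have "sup_inf_expectation A B P (\<lambda>z. c) = (SUP l\<in>A. INF m\<in>B. c)"
    unfolding sup_inf_expectation_def
    by (intro SUP_cong INF_cong refl expectation_const)
  then show ?thesis using A_ne B_ne by simp
qed

lemma sup_inf_expectation_cmult:
  assumes F: "bounded_measurable K F" and c: "0 \<le> c"
  shows "sup_inf_expectation A B P (\<lambda>z. c * F z) = c * sup_inf_expectation A B P F"
proof -
  have "(INF m\<in>B. \<integral>z. c * F z \<partial>P l m) = c * (INF m\<in>B. integral\<^sup>L (P l m) F)" if "l \<in> A" for l
    using cINF_mult_left_real[OF B_ne bdd_below_expectation[OF F that] c] by simp
  then show ?thesis
    unfolding sup_inf_expectation_def
    using cSUP_mult_left_real[OF A_ne bdd_above_INF_expectation[OF F] c] by simp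
qed

lemma sup_inf_expectation_cong:
  assumes "\<And>z. z \<in> space K \<Longrightarrow> F z = G z" shows "sup_inf_expectation A B P F = sup_inf_expectation A B P G"
proof -
  have "integral\<^sup>L (P l m) F = integral\<^sup>L (P l m) G" if "l \<in> A" "m \<in> B" for l m
    using assms space_P[OF that] by (intro Bochner_Integration.integral_cong) auto
  then show ?thesis by (simp add: sup_inf_expectation_def)
qed

end

section \<open>Games satisfying the dynamic programming principle\<close>

locale dynamic_programming_game =
  fixes g :: "'w \<Rightarrow> real"
    and Ks :: "(real \<Rightarrow> 'w) measure"
    and L :: "'w \<Rightarrow> 'l set" and M :: "'w \<Rightarrow> 'm set"
    and P :: "'w \<Rightarrow> 'l \<Rightarrow> 'm \<Rightarrow> (real \<Rightarrow> 'w) measure"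
  assumes g_range: "0 \<le> g \<omega> \<and> g \<omega> \<le> 1"
    and g_meas: "z \<in> space Ks \<Longrightarrow> set_borel_measurable lebesgue {0..} (\<lambda>t. g (z t))"
    and L_ne: "L \<omega> \<noteq> {}" and M_ne: "M \<omega> \<noteq> {}"
    and P_prob: "l \<in> L \<omega> \<Longrightarrow> m \<in> M \<omega> \<Longrightarrow> prob_space (P \<omega> l m)"
    and P_sets: "l \<in> L \<omega> \<Longrightarrow> m \<in> M \<omega> \<Longrightarrow> sets (P \<omega> l m) = sets Ks"
    and payoff_density_meas: "\<rho> \<in> density_set \<Longrightarrow> payoff g \<rho> \<in> borel_measurable Ks"
    and value_density_meas: "\<rho> \<in> density_set \<Longrightarrow> T > 0
      \<Longrightarrow> (\<lambda>z. game_value L M P g \<rho> (z T)) \<in> borel_measurable Ks"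
    and value_density_DPP: "\<rho> \<in> density_set \<Longrightarrow> 1 \<le> n \<Longrightarrow> game_value L M P g \<rho> \<omega> =
          (SUP l\<in>L \<omega>. INF m\<in>M \<omega>. \<integral>z. ((LINT t:{0..real n}|lebesgue. \<rho> t * g (z t))
              + game_value L M P g (\<lambda>t. \<rho> (t + real n)) (z (real n))) \<partial>P \<omega> l m)"
begin

sublocale prob_space_family Ks "L \<omega>" "M \<omega>" "P \<omega>" for \<omega>
  by (rule prob_space_family.intro) (rule L_ne M_ne P_prob P_sets; assumption)+

abbreviation V :: "(real \<Rightarrow> real) \<Rightarrow> 'w \<Rightarrow> real" where
  "V \<equiv> game_value L M P g"

abbreviation value_at :: "'w \<Rightarrow> ((real \<Rightarrow> 'w) \<Rightarrow> real) \<Rightarrow> real" where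
  "value_at \<omega> \<equiv> sup_inf_expectation (L \<omega>) (M \<omega>) (P \<omega>)"

lemma V_eq_value_at: "V f \<omega> = value_at \<omega> (payoff g f)"
  by (simp add: sup_inf_expectation_def game_value_def)

lemma abs_g_le: "\<bar>g \<omega>\<bar> \<le> 1"
  using g_range[of \<omega>] by simp

lemma payoff_diff_le:
  assumes z: "z \<in> space Ks" and f: "weight f" and h: "weight h"
  shows "\<bar>payoff g f z - payoff g h z\<bar> \<le> L1_dist f h"
proof -
  have "set_integrable lebesgue {0..} (\<lambda>t. f t * g (z t))" "set_integrable lebesgue {0..} (\<lambda>t. h t * g (z t))"
    using set_integrable_mult_bounded[OF weight_integrable g_meas[OF z] abs_g_le] f h by blast+
  then have "payoff g f z - payoff g h z = mass (\<lambda>t. (f t - h t) * g (z t))"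
    by (simp add: payoff_def left_diff_distrib)
  also have "\<bar>\<dots>\<bar> \<le> L1_dist f h"
    unfolding L1_dist_def using f h
    by (intro abs_set_integral_mult_bounded_le set_integral_diff weight_integrable g_meas z abs_g_le)
  finally show ?thesis .
qed

lemma payoff_nonneg: "weight f \<Longrightarrow> 0 \<le> payoff g f z"
  unfolding payoff_def using g_range by (intro set_integral_nonneg) (simp add: weight_nonneg)

lemma payoff_cmult: "payoff g (\<lambda>t. c * f t) z = c * payoff g f z"
  by (simp add: payoff_def mult.assoc)

lemma payoff_le_mass:
  assumes "z \<in> space Ks" "weight f" shows "payoff g f z \<le> mass f"
  using payoff_diff_le[OF assms(1,2) weight_cmult[OF assms(2), of 0]] payoff_cmult[of 0 f z]
    L1_dist_zero[OF assms(2)] by simp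

lemma payoff_eq_0: "z \<in> space Ks \<Longrightarrow> weight f \<Longrightarrow> mass f = 0 \<Longrightarrow> payoff g f z = 0"
  using payoff_le_mass[of z f] payoff_nonneg[of f z] by simp

lemma bounded_measurable_payoff:
  assumes f: "weight f" shows "bounded_measurable Ks (payoff g f)"
  unfolding bounded_measurable_def
proof
  show "payoff g f \<in> borel_measurable Ks"
    using f
  proof (cases rule: weight_density_cases)
    case null
    then show ?thesis using payoff_eq_0[OF _ f] by (subst measurable_cong[of Ks _ "\<lambda>_. 0"]) auto
  next
    case (scaled c \<rho>)
    then show ?thesis using payoff_density_meas[of \<rho>] by (simp add: payoff_cmult[abs_def])
  qed
  show "bounded (payoff g f ` space Ks)"
    using payoff_nonneg[OF f] payoff_le_mass[OF _ f] by (auto simp: bounded_real intro!: exI[of _ "mass f"])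
qed

sublocale weight_value V
proof
  fix f h :: "real \<Rightarrow> real" and \<omega> assume f: "weight f"
  show "0 \<le> V f \<omega>"
    using sup_inf_expectation_le_add_const[OF bounded_measurable_const[of _ 0]
        bounded_measurable_payoff[OF f], of 0 \<omega>] payoff_nonneg[OF f]
    by (simp add: V_eq_value_at sup_inf_expectation_const)
  show "V (\<lambda>t. c * f t) \<omega> = c * V f \<omega>" if "0 \<le> c" for c
    using sup_inf_expectation_cmult[OF bounded_measurable_payoff[OF f] that]
    by (simp add: V_eq_value_at payoff_cmult[abs_def])
  show "\<bar>V f \<omega> - V h \<omega>\<bar> \<le> L1_dist f h" if "weight h"
    unfolding V_eq_value_at
    by (intro sup_inf_expectation_diff_le bounded_measurable_payoff payoff_diff_le f that)
qed

lemma V_eq_0: "weight f \<Longrightarrow> mass f = 0 \<Longrightarrow> V f \<omega> = 0"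
  using V_nonneg[of f \<omega>] V_le_mass[of f \<omega>] by simp

lemma bounded_measurable_V:
  assumes f: "weight f" and T: "0 < T" shows "bounded_measurable Ks (\<lambda>z. V f (z T))"
  unfolding bounded_measurable_def
proof
  show "(\<lambda>z. V f (z T)) \<in> borel_measurable Ks"
    using f
  proof (cases rule: weight_density_cases)
    case null
    then show ?thesis by (simp add: V_eq_0[OF f])
  next
    case (scaled c \<rho>)
    then show ?thesis using value_density_meas[of \<rho> T] T by (simp add: V_cmult density_set_iff_weight)
  qed
  show "bounded ((\<lambda>z. V f (z T)) ` space Ks)"
    using V_nonneg[OF f] V_le_mass[OF f] by (auto simp: bounded_real intro!: exI[of _ "mass f"])
qed

definition continuation :: "(real \<Rightarrow> real) \<Rightarrow> nat \<Rightarrow> (real \<Rightarrow> 'w) \<Rightarrow> real" where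
  "continuation f n z = payoff g (truncate (real n) f) z + V (shift (real n) f) (z (real n))"

lemma continuation_eq:
  "continuation f n z
    = (LINT t:{0..real n}|lebesgue. f t * g (z t)) + V (\<lambda>t. f (t + real n)) (z (real n))"
proof -
  have "payoff g (truncate (real n) f) z = (LINT t:{0..real n}|lebesgue. f t * g (z t))"
    unfolding payoff_def truncate_def set_lebesgue_integral_def
    by (intro Bochner_Integration.integral_cong) (auto simp: indicator_def)
  then show ?thesis by (simp add: continuation_def shift_def)
qed

lemma bounded_measurable_continuation:
  "weight f \<Longrightarrow> 1 \<le> n \<Longrightarrow> bounded_measurable Ks (continuation f n)"
  unfolding continuation_def
  by (intro bounded_measurable_add bounded_measurable_payoff bounded_measurable_V
      weight_truncate weight_shift) auto

lemma continuation_cmult: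
  "weight f \<Longrightarrow> 0 \<le> c \<Longrightarrow> continuation (\<lambda>t. c * f t) n z = c * continuation f n z"
  using V_cmult[OF weight_shift[of f "real n"], of c "z (real n)"]
  by (simp add: continuation_eq shift_def mult.assoc distrib_left)

lemma continuation_eq_0:
  assumes z: "z \<in> space Ks" and f: "weight f" and "mass f = 0"
  shows "continuation f n z = 0"
proof -
  have head: "weight (truncate (real n) f)" and tail: "weight (shift (real n) f)"
    using f by (auto intro: weight_truncate weight_shift)
  have "mass (truncate (real n) f) = 0"
    using mass_truncate_le[OF f, of "real n"] mass_nonneg[OF head] assms(3) by simp
  moreover have "mass (shift (real n) f) = 0"
    using mass_shift_le[OF f, of "real n"] mass_nonneg[OF tail] assms(3) by simp
  ultimately show ?thesis by (simp add: continuation_def payoff_eq_0[OF z head] V_eq_0[OF tail])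
qed

lemma value_DPP:
  assumes f: "weight f" and n: "1 \<le> n"
  shows "V f \<omega> = value_at \<omega> (continuation f n)"
  using f
proof (cases rule: weight_density_cases)
  case null
  then have "value_at \<omega> (continuation f n) = value_at \<omega> (\<lambda>z. 0)"
    using continuation_eq_0[OF _ f] by (intro sup_inf_expectation_cong)
  then show ?thesis using V_eq_0[OF f null] by (simp add: sup_inf_expectation_const)
next
  case (scaled c \<rho>)
  have \<rho>: "weight \<rho>" using scaled by (simp add: density_set_iff_weight)
  have "V f \<omega> = c * V \<rho> \<omega>" using scaled \<rho> by (simp add: V_cmult)
  also have "V \<rho> \<omega> = value_at \<omega> (continuation \<rho> n)"
    using value_density_DPP[OF scaled(2) n, of \<omega>]
    by (simp add: sup_inf_expectation_def continuation_eq[abs_def])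
  also have "c * \<dots> = value_at \<omega> (\<lambda>z. c * continuation \<rho> n z)"
    using scaled by (intro sup_inf_expectation_cmult[symmetric] bounded_measurable_continuation \<rho> n) auto
  also have "(\<lambda>z. c * continuation \<rho> n z) = continuation f n"
    unfolding scaled(3) using scaled(1) by (intro ext continuation_cmult[OF \<rho>, symmetric]) simp
  finally show ?thesis .
qed

sublocale shift_comparable_value V
proof
  fix f h :: "real \<Rightarrow> real" and n :: nat and d :: real and \<omega>
  assume f: "weight f" and h: "weight h" and n: "1 \<le> n"
    and tails: "\<And>\<omega>. \<bar>V (shift (real n) f) \<omega> - V (shift (real n) h) \<omega>\<bar> \<le> d"
  have "\<bar>continuation f n z - continuation h n z\<bar> \<le> (LINT t:{0..<real n}|lebesgue. \<bar>f t - h t\<bar>) + d"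
    if "z \<in> space Ks" for z
  proof -
    have "\<bar>payoff g (truncate (real n) f) z - payoff g (truncate (real n) h) z\<bar>
        \<le> L1_dist (truncate (real n) f) (truncate (real n) h)"
      by (intro payoff_diff_le that weight_truncate f h)
    also have "\<dots> = (LINT t:{0..real n}|lebesgue. \<bar>f t - h t\<bar>)"
      unfolding L1_dist_def truncate_def set_lebesgue_integral_def
      by (intro Bochner_Integration.integral_cong) (auto simp: indicator_def)
    also have "\<dots> = (LINT t:{0..<real n}|lebesgue. \<bar>f t - h t\<bar>)"
      by (rule set_integral_discrete_difference[of "{real n}"]) auto
    finally show ?thesis using tails[of "z (real n)"] unfolding continuation_def by linarith
  qed
  then show "\<bar>V f \<omega> - V h \<omega>\<bar> \<le> (LINT t:{0..<real n}|lebesgue. \<bar>f t - h t\<bar>) + d"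
    unfolding value_DPP[OF f n] value_DPP[OF h n]
    by (intro sup_inf_expectation_diff_le bounded_measurable_continuation f h n)
qed

end

theorem theorem5:
  fixes g :: "'w \<Rightarrow> real"
    and Ks :: "(real \<Rightarrow> 'w) measure"
    and L :: "'w \<Rightarrow> 'l set" and M :: "'w \<Rightarrow> 'm set"
    and P :: "'w \<Rightarrow> 'l \<Rightarrow> 'm \<Rightarrow> (real \<Rightarrow> 'w) measure"
    and U :: "'w \<Rightarrow> real"
  assumes K_ne: "space Ks \<noteq> {}"
    and g_range: "\<And>\<omega>. 0 \<le> g \<omega> \<and> g \<omega> \<le> 1"
    and g_meas: "\<And>z. z \<in> space Ks \<Longrightarrow> set_borel_measurable lebesgue {0..} (\<lambda>t. g (z t))"
    and L_ne: "\<And>\<omega>. L \<omega> \<noteq> {}" and M_ne: "\<And>\<omega>. M \<omega> \<noteq> {}"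
    and P_prob: "\<And>\<omega> l m. l \<in> L \<omega> \<Longrightarrow> m \<in> M \<omega> \<Longrightarrow> prob_space (P \<omega> l m)"
    and P_sets: "\<And>\<omega> l m. l \<in> L \<omega> \<Longrightarrow> m \<in> M \<omega> \<Longrightarrow> sets (P \<omega> l m) = sets Ks"
    and J_meas: "\<And>\<rho>. \<rho> \<in> density_set \<Longrightarrow> payoff g \<rho> \<in> borel_measurable Ks"
    and V_meas: "\<And>\<rho> T. \<rho> \<in> density_set \<Longrightarrow> T > 0 \<Longrightarrow>
                   (\<lambda>z. game_value L M P g \<rho> (z T)) \<in> borel_measurable Ks"
    and DPP:
      "(\<forall>\<rho>\<in>density_set. \<forall>\<omega>. \<forall>T::real. T > 0 \<longrightarrow>
          game_value L M P g \<rho> \<omega> =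
          (SUP l\<in>L \<omega>. INF m\<in>M \<omega>. \<integral>z. ((LINT t:{0..T}|lebesgue. \<rho> t * g (z t))
              + game_value L M P g (\<lambda>t. \<rho> (t + T)) (z T)) \<partial>P \<omega> l m))
       \<or> ((\<forall>z\<in>space Ks. \<forall>n::nat. \<forall>s\<in>{0<..<1}. z (real n + s) = z (real n)) \<and>
          (\<forall>\<rho>\<in>density_set. \<forall>\<omega>. \<forall>n::nat. n \<ge> 1 \<longrightarrow>
          game_value L M P g \<rho> \<omega> =
          (SUP l\<in>L \<omega>. INF m\<in>M \<omega>. \<integral>z. ((LINT t:{0..real n}|lebesgue. \<rho> t * g (z t))
              + game_value L M P g (\<lambda>t. \<rho> (t + real n)) (z (real n))) \<partial>P \<omega> l m)))"
    and U_range: "\<And>\<omega>. 0 \<le> U \<omega> \<and> U \<omega> \<le> 1"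
  shows
   "let dev = (\<lambda>\<rho>. SUP \<omega>. \<bar>game_value L M P g \<rho> \<omega> - U \<omega>\<bar>);
        c = (\<forall>\<mu>\<in>density_set. piecewise_cont_pos \<mu> \<longrightarrow>
               ((\<lambda>lam. dev (rho_scale \<mu> lam)) \<longlongrightarrow> 0) (at_right 0));
        u = ((\<lambda>T. dev (uniform_dens T)) \<longlongrightarrow> 0) at_top;
        e = ((\<lambda>lam. dev (exp_dens lam)) \<longlongrightarrow> 0) (at_right 0);
        p = (\<exists>\<rho>. power_density \<rho> \<and> ((\<lambda>T. dev (rho_shift \<rho> T)) \<longlongrightarrow> 0) at_top);
        q = (\<forall>\<rho>. power_density \<rho> \<longrightarrow> ((\<lambda>T. dev (rho_shift \<rho> T)) \<longlongrightarrow> 0) at_top)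
    in (c \<longleftrightarrow> u) \<and> (u \<longleftrightarrow> e) \<and> (e \<longleftrightarrow> p) \<and> (p \<longleftrightarrow> q)"
proof -
  have DPP_nat: "game_value L M P g \<rho> \<omega> =
      (SUP l\<in>L \<omega>. INF m\<in>M \<omega>. \<integral>z. ((LINT t:{0..real n}|lebesgue. \<rho> t * g (z t))
          + game_value L M P g (\<lambda>t. \<rho> (t + real n)) (z (real n))) \<partial>P \<omega> l m)"
    if "\<rho> \<in> density_set" "1 \<le> n" for \<rho> \<omega> n
  proof -
    have "0 < real n" using that by simp
    with DPP that show ?thesis by blast
  qed
  interpret dynamic_programming_game g Ks L M P
    by (rule dynamic_programming_game.intro)
      (fact g_range g_meas L_ne M_ne P_prob P_sets J_meas V_meas DPP_nat)+
  interpret limit_candidate V U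
    by unfold_locales (rule U_range)
  show ?thesis
    unfolding Let_def
    using piecewise_cont_scale_limit_iff_cesaro uniform_dens_limit_iff_cesaro exp_dens_limit_iff_cesaro
      some_power_density_limit_iff_cesaro every_power_density_limit_iff_cesaro
    by blast
qed

end
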